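(* Let $\mathcal{Q}=(Q,I)$ be a locally gentle quiver with the generic weight function $w:Q_1\to\mathbb{Z}[x_e\mid e\in Q_1]$, $w(e)=x_e$, and let $C_{\mathcal{Q}}^w(x)$ be its weighted Cartan matrix. Then the determinant of this Cartan matrix is a rational function, given by the formula $$\det C_{\mathcal{Q}}^w(x) = \frac{\prod_{C\in\mathcal{ZC}(\mathcal{Q})} \bigl(1-(-1)^{l(C)}w(C)\bigr)}{\prod_{C\in\mathcal{IC}(\mathcal{Q})} \bigl(1-w(C)\bigr)}.$$
   Context: A quiver $Q$ is a directed graph with finitely many vertices (set $Q_0$) and finitely many arrows (set $Q_1$); loops and multiple arrows are allowed. For a path $p$, $s(p)$ and $t(p)$ are its start and end vertices; paths are written from left to right, so in the path algebra $KQ$ over a field $K$ the product $pq$ is the concatenation if $t(p)=s(q)$ and $0$ otherwise. For each vertex $i$ there is a trivial path $e_i$ of length $0$. An ideal $I\subseteq KQ$ is admissible if it is contained in the square of the ideal generated by the arrows. Locally gentle quiver: a pair $(Q,I)$ with $I$ an admissible ideal of $KQ$ such that: (G2) each vertex of $Q$ is the starting point of at most two arrows and the end point of at most two arrows; (G3) for each arrow $\alpha$ there is at most one arrow $\beta$ such that $\alpha\beta\notin I$, and at most one arrow $\gamma$ such that $\gamma\alpha\notin I$; (G4) $I$ is generated by paths of length $2$; (G5) for each arrow $\alpha$ there is at most one arrow $\beta'$ with $t(\alpha)=s(\beta')$ and $\alpha\beta'\in I$, and at most one arrow $\gamma'$ with $t(\gamma')=s(\alpha)$ and $\gamma'\alpha\in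 I$. Weights: for a path $p=\alpha_1\cdots\alpha_t$ in $Q$ with arrows $\alpha_i$ (whether or not $p$ lies in $I$), $w(p)=\prod_{i=1}^t w(\alpha_i)$ and $l(p)=t$; trivial paths have weight $1$ and length $0$. The $x_e$ are commuting indeterminates and $x=(x_e)_{e\in Q_1}$. Weighted Cartan matrix: the $|Q_0|\times|Q_0|$ matrix $C_{\mathcal{Q}}^w(x)=(c_{ij}(x))_{i,j\in Q_0}$ over the power series ring $\mathbb{Z}[[x_e\mid e\in Q_1]]$ with $c_{ij}(x)=\sum_p w(p)$, the sum over all paths $p$ from $i$ to $j$ in $Q$ that are non-zero in $A=KQ/I$ (i.e. $p\notin I$; trivial paths included). Cycles: a (minimal) oriented cycle with full relations is a closed path $C=\alpha_1\cdots\alpha_l$ ($l\ge1$) with pairwise distinct arrows such that $\alpha_i\alpha_{i+1}\in I$ for all $i$ (indices mod $l$); a (minimal) oriented cycle with no relations is a closed path $C=\alpha_1\cdots\alpha_l$ ($l\ge 1$) with pairwise distinct arrows such that $\alpha_i\alpha_{i+1}\notin I$ for all $i$ (indices mod $l$). Cycles are considered up to cyclic rotation. $\mathcal{ZC}(\mathcal{Q})$ and $\mathcal{IC}(\mathcal{Q})$ denote the sets of minimal oriented cycles with full relations and with no relations, respectively. *)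

theory Defs
  imports
    "HOL-Library.Multiset"
    "HOL-Algebra.Ideal_Product"
    "Graph_Theory.Arc_Walk"
    "Jordan_Normal_Form.Determinant"
begin

section \<open>Power series in commuting indeterminates\<close>

text \<open>
  A monomial in the indeterminates \<open>x\<^sub>e\<close> (\<open>e :: 'e\<close>) is a finite multiset over \<open>'e\<close>, and a power
  series is an arbitrary family of coefficients. The type \<open>'e\<close> may be infinite. For a set \<open>E\<close> of
  indeterminates, the series in \<open>x\<^sub>e\<close> (\<open>e \<in> E\<close>) form a subring.
\<close>

typedef (overloaded) ('e, 'a) mfps = "UNIV :: ('e multiset \<Rightarrow> 'a::zero) set"
  morphisms mfps_coeff Abs_mfps ..

lemma mfps_coeff_Abs [simp]: "mfps_coeff (Abs_mfps f) = f"
  by (simp add: Abs_mfps_inverse)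

lemma mfps_eqI: "(\<And>m. mfps_coeff f m = mfps_coeff g m) \<Longrightarrow> f = g"
  by (metis ext mfps_coeff_inject)

abbreviation msplits :: "'e multiset \<Rightarrow> ('e multiset \<times> 'e multiset) set" where
  "msplits m \<equiv> {(a, b). a + b = m}"

lemma finite_msplits [simp]: "finite (msplits m)"
proof (rule finite_subset)
  have *: "{a. a \<subseteq># m} \<subseteq> (\<lambda>xs. mset xs) ` {xs. set xs \<subseteq> set_mset m \<and> length xs \<le> size m}"
  proof
    fix a assume "a \<in> {a. a \<subseteq># m}"
    hence a: "a \<subseteq># m" by simp
    obtain xs where xs: "mset xs = a" by (rule ex_mset[THEN exE])
    hence "set xs \<subseteq> set_mset m" using a by (metis set_mset_mono set_mset_mset)
    moreover have "length xs \<le> size m" using a xs by (metis size_mset size_mset_mono)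
    ultimately show "a \<in> (\<lambda>xs. mset xs) ` {xs. set xs \<subseteq> set_mset m \<and> length xs \<le> size m}"
      using xs by blast
  qed
  have fin: "finite {a. a \<subseteq># m}"
    by (rule finite_subset[OF * finite_imageI]) (simp add: finite_lists_length_le)
  show "finite ({a. a \<subseteq># m} \<times> {a. a \<subseteq># m})" using fin by simp
  show "msplits m \<subseteq> {a. a \<subseteq># m} \<times> {a. a \<subseteq># m}" by auto
qed

instantiation mfps :: (type, comm_ring_1) comm_ring_1
begin

definition "0 = Abs_mfps (\<lambda>_. 0)"
definition "1 = Abs_mfps (\<lambda>m. if m = {#} then 1 else 0)"
definition "f + g = Abs_mfps (\<lambda>m. mfps_coeff f m + mfps_coeff g m)"
definition "f - g = Abs_mfps (\<lambda>m. mfps_coeff f m - mfps_coeff g m)"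
definition "- f = Abs_mfps (\<lambda>m. - mfps_coeff f m)"
definition "f * g = Abs_mfps (\<lambda>m. \<Sum>(a, b)\<in>msplits m. mfps_coeff f a * mfps_coeff g b)"

lemmas mfps_ring_defs = zero_mfps_def one_mfps_def plus_mfps_def minus_mfps_def
  uminus_mfps_def times_mfps_def

instance
proof
  fix f g h :: "('a, 'b) mfps"
  show "f * g * h = f * (g * h)"
  proof (rule mfps_eqI)
    fix m
    let ?F = "mfps_coeff f" and ?G = "mfps_coeff g" and ?H = "mfps_coeff h"
    have "mfps_coeff (f * g * h) m =
        (\<Sum>x\<in>msplits m. \<Sum>y\<in>msplits (fst x). ?F (fst y) * ?G (snd y) * ?H (snd x))"
      by (simp add: times_mfps_def sum_distrib_right case_prod_unfold)
    also have "\<dots> = (\<Sum>(x, y)\<in>(SIGMA x:msplits m. msplits (fst x)).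
        ?F (fst y) * ?G (snd y) * ?H (snd x))"
      by (rule sum.Sigma) simp_all
    also have "\<dots> = (\<Sum>(x, y)\<in>(SIGMA x:msplits m. msplits (snd x)).
        ?F (fst x) * (?G (fst y) * ?H (snd y)))"
      by (rule sum.reindex_bij_witness[where
            i = "\<lambda>(x, y). ((fst x + fst y, snd y), (fst x, fst y))" and
            j = "\<lambda>(x, y). ((fst y, snd y + snd x), (snd y, snd x))"])
         (auto simp: mult.assoc add.assoc)
    also have "\<dots> = (\<Sum>x\<in>msplits m. \<Sum>y\<in>msplits (snd x). ?F (fst x) * (?G (fst y) * ?H (snd y)))"
      by (rule sum.Sigma[symmetric]) simp_all
    also have "\<dots> = mfps_coeff (f * (g * h)) m"
      by (simp add: times_mfps_def sum_distrib_left case_prod_unfold)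
    finally show "mfps_coeff (f * g * h) m = mfps_coeff (f * (g * h)) m" .
  qed
  show "f * g = g * f"
  proof (rule mfps_eqI)
    fix m
    show "mfps_coeff (f * g) m = mfps_coeff (g * f) m"
      unfolding times_mfps_def mfps_coeff_Abs
      by (rule sum.reindex_bij_witness[where i = prod.swap and j = prod.swap])
         (auto simp: mult.commute add.commute)
  qed
  show "1 * f = f"
  proof (rule mfps_eqI)
    fix m
    have "mfps_coeff (1 * f) m =
        (\<Sum>x\<in>msplits m. (if fst x = {#} then 1 else 0) * mfps_coeff f (snd x))"
      by (simp add: mfps_ring_defs case_prod_unfold)
    also have "\<dots> = (\<Sum>x\<in>{({#} :: 'a multiset, m)}. (if fst x = {#} then 1 else 0) * mfps_coeff f (snd x))"
      by (rule sum.mono_neutral_right) auto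
    finally show "mfps_coeff (1 * f) m = mfps_coeff f m" by simp
  qed
  show "(f + g) * h = f * h + g * h"
    by (rule mfps_eqI)
       (simp add: plus_mfps_def times_mfps_def case_prod_unfold distrib_right sum.distrib)
  show "(0 :: ('a, 'b) mfps) \<noteq> 1"
  proof
    assume "(0 :: ('a, 'b) mfps) = 1"
    hence "mfps_coeff (0 :: ('a, 'b) mfps) {#} = mfps_coeff 1 {#}" by simp
    thus False by (simp add: mfps_ring_defs)
  qed
qed (auto intro!: mfps_eqI simp: mfps_ring_defs algebra_simps)

end

text \<open>Inverses are total: a series that is not a unit has inverse \<open>0\<close>.\<close>

instantiation mfps :: (type, comm_ring_1) inverse
begin

definition inverse_mfps :: "('a, 'b) mfps \<Rightarrow> ('a, 'b) mfps" where
  "inverse (f :: ('a, 'b) mfps) = (if f dvd 1 then (THE g. f * g = 1) else 0)"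

definition divide_mfps :: "('a, 'b) mfps \<Rightarrow> ('a, 'b) mfps \<Rightarrow> ('a, 'b) mfps" where
  "(f :: ('a, 'b) mfps) div g = f * inverse g"

instance ..

end

lemma mfps_mult_inverse:
  fixes f :: "('e, 'a::comm_ring_1) mfps"
  assumes "f dvd 1"
  shows "f * inverse f = 1"
proof -
  obtain g where g: "f * g = 1" using assms by (metis dvdE)
  have uniq: "h = g" if "f * h = 1" for h
  proof -
    have "h = (f * g) * h" by (simp add: g)
    also have "\<dots> = (f * h) * g" by (simp only: mult_ac)
    also have "\<dots> = g" by (simp add: that)
    finally show ?thesis .
  qed
  have "f * (THE g. f * g = 1) = 1"
    by (rule theI[where P = "\<lambda>g. f * g = 1"]) (fact g, erule uniq)
  thus ?thesis using assms by (simp add: inverse_mfps_def)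
qed

definition mfps_X :: "'e \<Rightarrow> ('e, 'a::comm_ring_1) mfps" where
  "mfps_X e = Abs_mfps (\<lambda>m. if m = {#e#} then 1 else 0)"

text \<open>
  The sum of a possibly infinite family of series, meaningful if the family is locally finite,
  i.e. if every monomial occurs in only finitely many members.
\<close>

definition mfps_sum :: "('i \<Rightarrow> ('e, 'a::comm_ring_1) mfps) \<Rightarrow> 'i set \<Rightarrow> ('e, 'a) mfps" where
  "mfps_sum f S = Abs_mfps (\<lambda>m. \<Sum>i | i \<in> S \<and> mfps_coeff (f i) m \<noteq> 0. mfps_coeff (f i) m)"

definition mfps_polynomial :: "'e set \<Rightarrow> ('e, 'a::comm_ring_1) mfps \<Rightarrow> bool" where
  "mfps_polynomial E f \<longleftrightarrow>
     finite {m. mfps_coeff f m \<noteq> 0} \<and> (\<forall>m. mfps_coeff f m \<noteq> 0 \<longrightarrow> set_mset m \<subseteq> E)"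

definition mfps_rational :: "'e set \<Rightarrow> ('e, 'a::comm_ring_1) mfps \<Rightarrow> bool" where
  "mfps_rational E f \<longleftrightarrow>
     (\<exists>p q. mfps_polynomial E p \<and> mfps_polynomial E q \<and> q \<noteq> 0 \<and> q * f = p)"


section \<open>Path algebras\<close>

text \<open>
  A quiver is a finite directed multigraph, \<^locale>\<open>fin_digraph\<close>. A path is a pair of its start
  vertex and its list of arrows, so \<open>(i, [])\<close> is the trivial path at \<open>i\<close>. The end vertex of
  \<open>(u, p)\<close> is \<open>pre_digraph.awlast Q u p\<close>. Elements of the path algebra are the finitely supported
  families of scalars indexed by paths.
\<close>

definition quiver_paths :: "('v, 'e) pre_digraph \<Rightarrow> ('v \<times> 'e list) set" where
  "quiver_paths Q = {(u, p). \<exists>v. pre_digraph.awalk Q u p v}"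

abbreviation lsplits :: "'e list \<Rightarrow> ('e list \<times> 'e list) set" where
  "lsplits r \<equiv> {(p, q). p @ q = r}"

definition path_algebra :: "('v, 'e) pre_digraph \<Rightarrow> ('v \<times> 'e list \<Rightarrow> 'k::field) ring" where
  "path_algebra Q =
     \<lparr> carrier = {f. finite {p. f p \<noteq> 0} \<and> {p. f p \<noteq> 0} \<subseteq> quiver_paths Q},
       monoid.mult = (\<lambda>f g (u, r). \<Sum>(p, q)\<in>lsplits r. f (u, p) * g (pre_digraph.awlast Q u p, q)),
       monoid.one = (\<lambda>(u, r). if u \<in> verts Q \<and> r = [] then 1 else 0),
       ring.zero = (\<lambda>_. 0),
       ring.add = (\<lambda>f g p. f p + g p) \<rparr>"

definition path_elt :: "'v \<times> 'e list \<Rightarrow> ('v \<times> 'e list \<Rightarrow> 'k::field)" where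
  "path_elt p = (\<lambda>q. if q = p then 1 else 0)"

definition arrow_elt :: "('v, 'e) pre_digraph \<Rightarrow> 'e \<Rightarrow> ('v \<times> 'e list \<Rightarrow> 'k::field)" where
  "arrow_elt Q a = path_elt (tail Q a, [a])"

lemma finite_lsplits [simp]: "finite (lsplits r)"
proof (rule finite_subset)
  show "lsplits r \<subseteq> (\<lambda>n. (take n r, drop n r)) ` {..length r}"
  proof
    fix x assume "x \<in> lsplits r"
    then obtain p q where "x = (p, q)" "p @ q = r" by auto
    thus "x \<in> (\<lambda>n. (take n r, drop n r)) ` {..length r}"
      by (intro image_eqI[where x = "length p"]) auto
  qed
qed simp

lemma awlast_append:
  "pre_digraph.awlast Q u (p @ q) = pre_digraph.awlast Q (pre_digraph.awlast Q u p) q"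
  by (simp add: pre_digraph.awalk_verts_conv)

lemma cas_append:
  "pre_digraph.cas Q u p v \<Longrightarrow> pre_digraph.cas Q v q w \<Longrightarrow> pre_digraph.cas Q u (p @ q) w"
  by (induction p arbitrary: u) (auto simp: pre_digraph.cas.simps)

lemma cas_awlast: "pre_digraph.cas Q u p v \<Longrightarrow> pre_digraph.awlast Q u p = v"
  by (induction p arbitrary: u)
     (auto simp: pre_digraph.cas.simps pre_digraph.awalk_verts.simps pre_digraph.awalk_verts_conv)

lemma quiver_paths_append:
  assumes "(u, p) \<in> quiver_paths Q" "(pre_digraph.awlast Q u p, q) \<in> quiver_paths Q"
  shows "(u, p @ q) \<in> quiver_paths Q"
  using assms by (auto simp: quiver_paths_def pre_digraph.awalk_def dest: cas_awlast intro: cas_append)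

lemma path_algebra_mult_closed:
  fixes f g :: "'v \<times> 'e list \<Rightarrow> 'k::field"
  assumes f: "f \<in> carrier (path_algebra Q)" and g: "g \<in> carrier (path_algebra Q)"
  shows "f \<otimes>\<^bsub>path_algebra Q\<^esub> g \<in> carrier (path_algebra Q)"
proof -
  let ?S = "{x. (f \<otimes>\<^bsub>path_algebra Q\<^esub> g) x \<noteq> 0}"
  have *: "\<exists>p q. r = p @ q \<and> f (u, p) \<noteq> 0 \<and> g (pre_digraph.awlast Q u p, q) \<noteq> 0"
    if "(u, r) \<in> ?S" for u r
  proof -
    from that have "(\<Sum>(p, q)\<in>lsplits r. f (u, p) * g (pre_digraph.awlast Q u p, q)) \<noteq> 0"
      by (simp add: path_algebra_def)
    then obtain x where "x \<in> lsplits r"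
      "(case x of (p, q) \<Rightarrow> f (u, p) * g (pre_digraph.awlast Q u p, q)) \<noteq> 0"
      by (rule sum.not_neutral_contains_not_neutral)
    thus ?thesis by (cases x) auto
  qed
  have "?S \<subseteq> (\<lambda>(x, y). (fst x, snd x @ snd y)) ` ({x. f x \<noteq> 0} \<times> {x. g x \<noteq> 0})"
  proof
    fix x assume x: "x \<in> ?S"
    obtain u r where ur: "x = (u, r)" by (cases x)
    from *[OF x[unfolded ur]] obtain p q
      where "r = p @ q" "f (u, p) \<noteq> 0" "g (pre_digraph.awlast Q u p, q) \<noteq> 0" by blast
    thus "x \<in> (\<lambda>(x, y). (fst x, snd x @ snd y)) ` ({x. f x \<noteq> 0} \<times> {x. g x \<noteq> 0})"
      by (intro image_eqI[where x = "((u, p), (pre_digraph.awlast Q u p, q))"]) (auto simp: ur)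
  qed
  hence "finite ?S"
    by (rule finite_subset) (use f g in \<open>simp add: path_algebra_def\<close>)
  moreover have "?S \<subseteq> quiver_paths Q"
  proof
    fix x assume x: "x \<in> ?S"
    obtain u r where ur: "x = (u, r)" by (cases x)
    from *[OF x[unfolded ur]] obtain p q
      where "r = p @ q" "f (u, p) \<noteq> 0" "g (pre_digraph.awlast Q u p, q) \<noteq> 0" by blast
    moreover have "{p. f p \<noteq> 0} \<subseteq> quiver_paths Q" "{p. g p \<noteq> 0} \<subseteq> quiver_paths Q"
      using f g by (simp_all add: path_algebra_def)
    ultimately show "x \<in> quiver_paths Q" unfolding ur
      by (metis (mono_tags, lifting) mem_Collect_eq quiver_paths_append subsetD)
  qed
  ultimately show ?thesis by (simp add: path_algebra_def)
qed

lemma ring_path_algebra: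
  assumes "fin_digraph Q"
  shows "ring (path_algebra Q :: ('v \<times> 'e list \<Rightarrow> 'k::field) ring)"
proof -
  interpret fin_digraph Q by fact
  let ?R = "path_algebra Q :: ('v \<times> 'e list \<Rightarrow> 'k::field) ring"
  have add_closed: "f \<oplus>\<^bsub>?R\<^esub> g \<in> carrier ?R" if "f \<in> carrier ?R" "g \<in> carrier ?R" for f g
  proof -
    have "{x. f x + g x \<noteq> 0} \<subseteq> {x. f x \<noteq> 0} \<union> {x. g x \<noteq> 0}" by auto
    moreover have "finite ({x. f x \<noteq> 0} \<union> {x. g x \<noteq> 0})"
      "{x. f x \<noteq> 0} \<union> {x. g x \<noteq> 0} \<subseteq> quiver_paths Q"
      using that by (auto simp: path_algebra_def)
    ultimately show ?thesis
      unfolding path_algebra_def by (simp, meson finite_subset order_trans)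
  qed
  have one_closed: "\<one>\<^bsub>?R\<^esub> \<in> carrier ?R"
  proof -
    have "{x. \<one>\<^bsub>?R\<^esub> x \<noteq> 0} \<subseteq> (\<lambda>u. (u, [])) ` verts Q"
      by (auto simp: path_algebra_def split: if_splits)
    moreover have "(\<lambda>u. (u, [])) ` verts Q \<subseteq> quiver_paths Q"
      by (auto simp: quiver_paths_def awalk_def)
    ultimately show ?thesis
      using finite_subset[of "{x. \<one>\<^bsub>?R\<^esub> x \<noteq> 0}" "(\<lambda>u. (u, [])) ` verts Q"]
      by (auto simp: path_algebra_def)
  qed
  have lsplit_one: "(\<Sum>x\<in>lsplits r. (if fst x = [] then 1 else 0) * h x) = h ([], r)"
    for r :: "'e list" and h :: "'e list \<times> 'e list \<Rightarrow> 'k"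
  proof -
    have "(\<Sum>x\<in>lsplits r. (if fst x = [] then 1 else 0) * h x) =
        (\<Sum>x\<in>{([], r)}. (if fst x = [] then 1 else 0) * h x)"
      by (rule sum.mono_neutral_right) auto
    thus ?thesis by simp
  qed
  have rsplit_one: "(\<Sum>x\<in>lsplits r. h x * (if snd x = [] then 1 else 0)) = h (r, [])"
    for r :: "'e list" and h :: "'e list \<times> 'e list \<Rightarrow> 'k"
  proof -
    have "(\<Sum>x\<in>lsplits r. h x * (if snd x = [] then 1 else 0)) =
        (\<Sum>x\<in>{(r, [])}. h x * (if snd x = [] then 1 else 0))"
      by (rule sum.mono_neutral_right) auto
    thus ?thesis by simp
  qed
  have paths: "f (u, p) = 0" if "f \<in> carrier ?R" "u \<notin> verts Q \<or> awlast u p \<notin> verts Q" for f u p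
  proof (rule ccontr)
    assume "f (u, p) \<noteq> 0"
    hence "(u, p) \<in> quiver_paths Q" using that by (auto simp: path_algebra_def)
    then obtain v where "awalk u p v" by (auto simp: quiver_paths_def)
    thus False using that awlast_in_verts[of u p] by (auto simp: awalk_def)
  qed
  have one_mult: "\<one>\<^bsub>?R\<^esub> \<otimes>\<^bsub>?R\<^esub> f = f" if f: "f \<in> carrier ?R" for f
  proof
    fix x :: "'v \<times> 'e list"
    obtain u r where x: "x = (u, r)" by (cases x)
    show "(\<one>\<^bsub>?R\<^esub> \<otimes>\<^bsub>?R\<^esub> f) x = f x"
    proof (cases "u \<in> verts Q")
      case True
      have "(\<one>\<^bsub>?R\<^esub> \<otimes>\<^bsub>?R\<^esub> f) x =
        (\<Sum>x\<in>lsplits r. (if fst x = [] then 1 else 0) * f (awlast u (fst x), snd x))"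
        using True by (simp add: path_algebra_def x case_prod_unfold)
      also have "\<dots> = f x" by (subst lsplit_one) (simp add: x)
      finally show ?thesis .
    next
      case False
      thus ?thesis using paths[OF f] by (simp add: path_algebra_def x)
    qed
  qed
  have mult_one: "f \<otimes>\<^bsub>?R\<^esub> \<one>\<^bsub>?R\<^esub> = f" if f: "f \<in> carrier ?R" for f
  proof
    fix x :: "'v \<times> 'e list"
    obtain u r where x: "x = (u, r)" by (cases x)
    have "(f \<otimes>\<^bsub>?R\<^esub> \<one>\<^bsub>?R\<^esub>) x =
      (\<Sum>x\<in>lsplits r. f (u, fst x) * (if snd x = [] then 1 else 0))"
      unfolding path_algebra_def using paths[OF f, of u]
      by (auto simp: x case_prod_unfold intro!: sum.cong)
    also have "\<dots> = f x" by (subst rsplit_one) (simp add: x)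
    finally show "(f \<otimes>\<^bsub>?R\<^esub> \<one>\<^bsub>?R\<^esub>) x = f x" .
  qed
  have assoc: "(f \<otimes>\<^bsub>?R\<^esub> g) \<otimes>\<^bsub>?R\<^esub> h = f \<otimes>\<^bsub>?R\<^esub> (g \<otimes>\<^bsub>?R\<^esub> h)" for f g h
  proof
    fix z :: "'v \<times> 'e list"
    obtain u r where z: "z = (u, r)" by (cases z)
    let ?L = "\<lambda>u p. awlast u p"
    have "((f \<otimes>\<^bsub>?R\<^esub> g) \<otimes>\<^bsub>?R\<^esub> h) z = (\<Sum>x\<in>lsplits r. \<Sum>y\<in>lsplits (fst x).
        f (u, fst y) * g (?L u (fst y), snd y) * h (?L u (fst x), snd x))"
      by (simp add: path_algebra_def z sum_distrib_right case_prod_unfold)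
    also have "\<dots> = (\<Sum>(x, y)\<in>(SIGMA x:lsplits r. lsplits (fst x)).
        f (u, fst y) * g (?L u (fst y), snd y) * h (?L u (fst x), snd x))"
      by (rule sum.Sigma) simp_all
    also have "\<dots> = (\<Sum>(x, y)\<in>(SIGMA x:lsplits r. lsplits (snd x)).
        f (u, fst x) * (g (?L u (fst x), fst y) * h (?L (?L u (fst x)) (fst y), snd y)))"
      by (rule sum.reindex_bij_witness[where
            i = "\<lambda>(x, y). ((fst x @ fst y, snd y), (fst x, fst y))" and
            j = "\<lambda>(x, y). ((fst y, snd y @ snd x), (snd y, snd x))"])
         (auto simp: mult.assoc awlast_append simp del: awlast_if_cas)
    also have "\<dots> = (\<Sum>x\<in>lsplits r. \<Sum>y\<in>lsplits (snd x).
        f (u, fst x) * (g (?L u (fst x), fst y) * h (?L (?L u (fst x)) (fst y), snd y)))"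
      by (rule sum.Sigma[symmetric]) simp_all
    also have "\<dots> = (f \<otimes>\<^bsub>?R\<^esub> (g \<otimes>\<^bsub>?R\<^esub> h)) z"
      by (simp add: path_algebra_def z sum_distrib_left case_prod_unfold)
    finally show "((f \<otimes>\<^bsub>?R\<^esub> g) \<otimes>\<^bsub>?R\<^esub> h) z = (f \<otimes>\<^bsub>?R\<^esub> (g \<otimes>\<^bsub>?R\<^esub> h)) z" .
  qed
  show ?thesis
  proof (rule ringI)
    show "abelian_group ?R"
    proof (rule abelian_groupI)
      fix f assume f: "f \<in> carrier ?R"
      show "\<exists>g\<in>carrier ?R. g \<oplus>\<^bsub>?R\<^esub> f = \<zero>\<^bsub>?R\<^esub>"
        by (rule bexI[of _ "\<lambda>x. - f x"]) (use f in \<open>auto simp: path_algebra_def\<close>)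
    qed (simp_all add: add_closed, simp_all add: path_algebra_def algebra_simps)
    show "Group.monoid ?R"
      by (rule monoidI)
         (simp_all add: one_closed one_mult mult_one assoc path_algebra_mult_closed)
    fix f g h assume "f \<in> carrier ?R" "g \<in> carrier ?R" "h \<in> carrier ?R"
    show "(f \<oplus>\<^bsub>?R\<^esub> g) \<otimes>\<^bsub>?R\<^esub> h = f \<otimes>\<^bsub>?R\<^esub> h \<oplus>\<^bsub>?R\<^esub> g \<otimes>\<^bsub>?R\<^esub> h"
      by (auto simp: path_algebra_def case_prod_unfold distrib_right sum.distrib)
    show "h \<otimes>\<^bsub>?R\<^esub> (f \<oplus>\<^bsub>?R\<^esub> g) = h \<otimes>\<^bsub>?R\<^esub> f \<oplus>\<^bsub>?R\<^esub> h \<otimes>\<^bsub>?R\<^esub> g"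
      by (auto simp: path_algebra_def case_prod_unfold distrib_left sum.distrib)
  qed
qed


section \<open>Locally gentle quivers\<close>

definition arrow_ideal :: "('v, 'e) pre_digraph \<Rightarrow> ('v \<times> 'e list \<Rightarrow> 'k::field) set" where
  "arrow_ideal Q = genideal (path_algebra Q) (arrow_elt Q ` arcs Q)"

definition admissible_ideal ::
  "('v, 'e) pre_digraph \<Rightarrow> ('v \<times> 'e list \<Rightarrow> 'k::field) set \<Rightarrow> bool" where
  "admissible_ideal Q I \<longleftrightarrow>
     ideal I (path_algebra Q) \<and>
     I \<subseteq> ideal_prod (path_algebra Q) (arrow_ideal Q) (arrow_ideal Q)"

text \<open>\<open>arrow_prod_in Q I \<alpha> \<beta>\<close> means \<open>\<alpha>\<beta> \<in> I\<close>, which holds trivially if the head of \<open>\<alpha>\<close> is not the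
  tail of \<open>\<beta>\<close>, since then \<open>\<alpha>\<beta> = 0\<close>.\<close>

definition arrow_prod_in ::
  "('v, 'e) pre_digraph \<Rightarrow> ('v \<times> 'e list \<Rightarrow> 'k::field) set \<Rightarrow> 'e \<Rightarrow> 'e \<Rightarrow> bool" where
  "arrow_prod_in Q I a b \<longleftrightarrow> arrow_elt Q a \<otimes>\<^bsub>path_algebra Q\<^esub> arrow_elt Q b \<in> I"

definition locally_gentle ::
  "('v, 'e) pre_digraph \<Rightarrow> ('v \<times> 'e list \<Rightarrow> 'k::field) set \<Rightarrow> bool" where
  "locally_gentle Q I \<longleftrightarrow>
     fin_digraph Q \<and> admissible_ideal Q I \<and>
     (\<forall>v\<in>verts Q. card (out_arcs Q v) \<le> 2 \<and> card (in_arcs Q v) \<le> 2) \<and>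
     (\<forall>a\<in>arcs Q. (\<exists>\<^sub>\<le>\<^sub>1 b. b \<in> arcs Q \<and> \<not> arrow_prod_in Q I a b) \<and>
                 (\<exists>\<^sub>\<le>\<^sub>1 c. c \<in> arcs Q \<and> \<not> arrow_prod_in Q I c a)) \<and>
     (\<exists>S. S \<subseteq> {p \<in> quiver_paths Q. length (snd p) = 2} \<and>
          I = genideal (path_algebra Q) (path_elt ` S)) \<and>
     (\<forall>a\<in>arcs Q. (\<exists>\<^sub>\<le>\<^sub>1 b. b \<in> arcs Q \<and> head Q a = tail Q b \<and> arrow_prod_in Q I a b) \<and>
                 (\<exists>\<^sub>\<le>\<^sub>1 c. c \<in> arcs Q \<and> head Q c = tail Q a \<and> arrow_prod_in Q I c a))"


section \<open>Weighted Cartan matrices and minimal oriented cycles\<close>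

definition path_weight :: "('e \<Rightarrow> 'a::comm_monoid_mult) \<Rightarrow> 'e list \<Rightarrow> 'a" where
  "path_weight w p = prod_list (map w p)"

definition cartan_entry :: "('v, 'e) pre_digraph \<Rightarrow> ('v \<times> 'e list \<Rightarrow> 'k::field) set \<Rightarrow>
    ('e \<Rightarrow> ('e, 'a::comm_ring_1) mfps) \<Rightarrow> 'v \<Rightarrow> 'v \<Rightarrow> ('e, 'a) mfps" where
  "cartan_entry Q I w i j =
     mfps_sum (path_weight w) {p. pre_digraph.awalk Q i p j \<and> path_elt (i, p) \<notin> I}"

text \<open>The list \<open>vs\<close> is an enumeration of the vertices, which orders the rows and columns.\<close>

definition cartan_matrix :: "('v, 'e) pre_digraph \<Rightarrow> ('v \<times> 'e list \<Rightarrow> 'k::field) set \<Rightarrow>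
    ('e \<Rightarrow> ('e, 'a::comm_ring_1) mfps) \<Rightarrow> 'v list \<Rightarrow> ('e, 'a) mfps mat" where
  "cartan_matrix Q I w vs =
     mat (length vs) (length vs) (\<lambda>(i, j). cartan_entry Q I w (vs ! i) (vs ! j))"

text \<open>For the generic weights, the families summed in the Cartan matrix are locally finite.\<close>

lemma mfps_coeff_X: "mfps_coeff (mfps_X e) m = (if m = {#e#} then 1 else 0)"
  by (simp add: mfps_X_def)

lemma mfps_coeff_path_weight_X:
  "mfps_coeff (path_weight mfps_X p :: ('e, 'a::comm_ring_1) mfps) m =
     (if m = mset p then 1 else 0)"
proof (induction p arbitrary: m)
  case Nil
  show ?case by (simp add: path_weight_def one_mfps_def)
next
  case (Cons e p)
  have "mfps_coeff (path_weight mfps_X (e # p) :: ('e, 'a) mfps) m =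
      (\<Sum>x\<in>msplits m. (if fst x = {#e#} then 1 else 0) * (if snd x = mset p then 1 else 0))"
    using Cons.IH by (simp add: path_weight_def times_mfps_def case_prod_unfold mfps_coeff_X)
  also have "\<dots> = (\<Sum>x\<in>msplits m. if x = ({#e#}, mset p) then 1 else 0)"
    by (rule sum.cong) (auto simp: prod_eq_iff)
  also have "\<dots> = (if m = mset (e # p) then 1 else 0)"
    by (subst sum.delta) auto
  finally show ?case .
qed

lemma finite_mset_fibre: "finite {p. p \<in> S \<and> mset p = m}"
proof (rule finite_subset)
  show "finite {p. set p \<subseteq> set_mset m \<and> length p = size m}"
    by (simp add: finite_lists_length_eq)
  show "{p. p \<in> S \<and> mset p = m} \<subseteq> {p. set p \<subseteq> set_mset m \<and> length p = size m}"
    by auto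
qed

lemma mfps_coeff_cartan_entry_X:
  "mfps_coeff (cartan_entry Q I mfps_X i j) m =
     of_nat (card {p. pre_digraph.awalk Q i p j \<and> path_elt (i, p) \<notin> I \<and> mset p = m})"
  by (auto simp: cartan_entry_def mfps_sum_def mfps_coeff_path_weight_X conj_assoc
           intro!: arg_cong[where f = card] arg_cong[where f = of_nat])

definition full_relation_cycle ::
  "('v, 'e) pre_digraph \<Rightarrow> ('v \<times> 'e list \<Rightarrow> 'k::field) set \<Rightarrow> 'e list \<Rightarrow> bool" where
  "full_relation_cycle Q I C \<longleftrightarrow>
     C \<noteq> [] \<and> (\<exists>u. pre_digraph.trail Q u C u) \<and>
     (\<forall>i<length C. arrow_prod_in Q I (C ! i) (C ! (Suc i mod length C)))"

definition no_relation_cycle ::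
  "('v, 'e) pre_digraph \<Rightarrow> ('v \<times> 'e list \<Rightarrow> 'k::field) set \<Rightarrow> 'e list \<Rightarrow> bool" where
  "no_relation_cycle Q I C \<longleftrightarrow>
     C \<noteq> [] \<and> (\<exists>u. pre_digraph.trail Q u C u) \<and>
     (\<forall>i<length C. \<not> arrow_prod_in Q I (C ! i) (C ! (Suc i mod length C)))"

definition rotation :: "('e list \<times> 'e list) set" where
  "rotation = {(p, q). \<exists>n. q = rotate n p}"

definition ZC :: "('v, 'e) pre_digraph \<Rightarrow> ('v \<times> 'e list \<Rightarrow> 'k::field) set \<Rightarrow> 'e list set set" where
  "ZC Q I = {C. full_relation_cycle Q I C} // rotation"

definition IC :: "('v, 'e) pre_digraph \<Rightarrow> ('v \<times> 'e list \<Rightarrow> 'k::field) set \<Rightarrow> 'e list set set" where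
  "IC Q I = {C. no_relation_cycle Q I C} // rotation"

text \<open>Length and weight are invariant under rotation, so they are defined on rotation classes.\<close>

definition cycle_length :: "'e list set \<Rightarrow> nat" where
  "cycle_length C = the_elem (length ` C)"

definition cycle_weight :: "('e \<Rightarrow> 'a::comm_monoid_mult) \<Rightarrow> 'e list set \<Rightarrow> 'a" where
  "cycle_weight w C = the_elem (path_weight w ` C)"

lemma equiv_rotation: "equiv UNIV (rotation :: ('e list \<times> 'e list) set)"
proof (rule equivI)
  show "refl (rotation :: ('e list \<times> 'e list) set)"
    by (auto simp: refl_on_def rotation_def intro: exI[of _ 0])
  show "sym (rotation :: ('e list \<times> 'e list) set)"
  proof (rule symI)
    fix p q :: "'e list" assume "(p, q) \<in> rotation"
    then obtain n where q: "q = rotate n p" by (auto simp: rotation_def)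
    have "rotate (length p - n mod length p) q = p"
    proof (cases "p = []")
      case False
      have "rotate (length p - n mod length p) q =
          rotate ((length p - n mod length p + n mod length p) mod length p) p"
        by (metis q rotate_conv_mod rotate_rotate)
      also have "\<dots> = p" using False by simp
      finally show ?thesis .
    qed (simp add: q)
    thus "(q, p) \<in> rotation" by (auto simp: rotation_def intro: sym)
  qed
  show "trans (rotation :: ('e list \<times> 'e list) set)"
    by (auto simp: trans_def rotation_def rotate_rotate)
qed simp

lemma cycle_length_class: "cycle_length (rotation `` {C}) = length C"
proof -
  have "C \<in> rotation `` {C}" by (simp add: rotation_def exI[of _ 0])
  moreover have "length D = length C" if "D \<in> rotation `` {C}" for D
    using that by (auto simp: rotation_def)
  ultimately have "length ` (rotation `` {C}) = {length C}" by blast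
  thus ?thesis by (simp add: cycle_length_def)
qed

lemma cycle_weight_class: "cycle_weight w (rotation `` {C}) = path_weight w C"
proof -
  have mset_rotate: "mset (rotate n C) = mset C" for n
  proof (induction n)
    case (Suc n)
    have "mset (rotate1 D) = mset D" for D :: "'b list" by (cases D) simp_all
    thus ?case using Suc by simp
  qed simp
  have rot: "path_weight w D = path_weight w C" if "D \<in> rotation `` {C}" for D
  proof -
    from that obtain n where "D = rotate n C" by (auto simp: rotation_def)
    hence "mset (map w D) = mset (map w C)" by (simp add: mset_rotate)
    thus ?thesis unfolding path_weight_def by (metis prod_mset_prod_list)
  qed
  have "C \<in> rotation `` {C}" by (simp add: rotation_def exI[of _ 0])
  hence "path_weight w ` (rotation `` {C}) = {path_weight w C}" using rot by blast
  thus ?thesis by (simp add: cycle_weight_def)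
qed

end

theory Submission
  imports Defs
begin

text \<open>
  The determinant is moved from vertices to arrows. Index square matrices by the arrows of \<open>Q\<close>. Let \<open>X\<close> be
  the diagonal matrix of the indeterminates, and let \<open>N\<close> and \<open>R\<close> be the 0-1 matrices of those composable
  pairs \<open>(a, b)\<close> with \<open>ab\<close> outside, respectively inside, \<open>I\<close>. Since \<open>I\<close> is generated by paths of length two,
  a path is non-zero in the quotient exactly if all its consecutive pairs of arrows lie outside \<open>I\<close>
  (\<open>path_notin_ideal_iff\<close>). So the Cartan matrix \<open>C\<close> counts walks in the graph \<open>N\<close>, and decomposing a walk
  by its first arrow, together with Sylvester's identity \<open>det (1 + F G) = det (1 + G F)\<close>, yields

    \<open>det (1 - X N) * det C = det (1 + X R)\<close>  (\<open>det_walk_matrix\<close>).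

  Conditions (G3) and (G5) say that \<open>N\<close> and \<open>R\<close> are partial bijections on the arrows. For a partial
  bijection with weights, \<open>det (1 + M)\<close> is the product over its cycles of \<open>1 - (-1) ^ l * w\<close>, where \<open>l\<close> is
  the length of the cycle and \<open>w\<close> the product of its weights (\<open>det_partial_bijection\<close>). The cycles of
  \<open>R\<close> are the cycles with full relations, which gives the numerator. Those of \<open>N\<close> are the cycles with no
  relations, and there the weights \<open>- x\<close> cancel the sign, which gives the denominator. The denominator is a
  product of factors \<open>1 - m\<close> with \<open>m\<close> a non-trivial monomial, hence invertible (\<open>monom_geometric_unit\<close>).
\<close>

section \<open>Block determinants and Sylvester's identity\<close>

lemma det_unit_columns:
  fixes M :: "'a::comm_ring_1 mat"
  assumes "M \<in> carrier_mat (n + m) (n + m)"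
    and "\<And>i j. i < n + m \<Longrightarrow> n \<le> j \<Longrightarrow> j < n + m \<Longrightarrow> M $$ (i, j) = of_bool (i = j)"
  shows "det M = det (mat n n (\<lambda>(i, j). M $$ (i, j)))"
  using assms
proof (induction m arbitrary: M)
  case 0
  then have "mat n n (\<lambda>(i, j). M $$ (i, j)) = M" by (intro eq_matI) auto
  then show ?case by simp
next
  case (Suc m)
  let ?k = "n + m"
  have M: "M \<in> carrier_mat (Suc ?k) (Suc ?k)" using Suc.prems(1) by simp
  have "det M = (\<Sum>i<Suc ?k. M $$ (i, ?k) * cofactor M i ?k)"
    by (rule laplace_expansion_column[OF M]) simp
  also have "\<dots> = (\<Sum>i<Suc ?k. of_bool (i = ?k) * cofactor M i ?k)"
    by (rule sum.cong) (use Suc.prems(2) in auto)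
  also have "\<dots> = det (mat_delete M ?k ?k)"
    by (simp add: cofactor_def)
  also have "\<dots> = det (mat n n (\<lambda>(i, j). mat_delete M ?k ?k $$ (i, j)))"
    by (rule Suc.IH) (use M Suc.prems(2) in \<open>auto simp: mat_delete_def\<close>)
  also have "mat n n (\<lambda>(i, j). mat_delete M ?k ?k $$ (i, j)) = mat n n (\<lambda>(i, j). M $$ (i, j))"
    by (rule eq_matI) (use M in \<open>auto simp: mat_delete_def\<close>)
  finally show ?case .
qed

lemma det_unit_rows:
  fixes M :: "'a::comm_ring_1 mat"
  assumes "M \<in> carrier_mat (n + m) (n + m)"
    and "\<And>i j. i < n \<Longrightarrow> j < n + m \<Longrightarrow> M $$ (i, j) = of_bool (i = j)"
  shows "det M = det (mat m m (\<lambda>(i, j). M $$ (n + i, n + j)))"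
  using assms
proof (induction n arbitrary: M)
  case 0
  then have "mat m m (\<lambda>(i, j). M $$ (0 + i, 0 + j)) = M" by (intro eq_matI) auto
  then show ?case by simp
next
  case (Suc n)
  let ?k = "n + m"
  have M: "M \<in> carrier_mat (Suc ?k) (Suc ?k)" using Suc.prems(1) by simp
  have "det M = (\<Sum>j<Suc ?k. M $$ (0, j) * cofactor M 0 j)"
    by (rule laplace_expansion_row[OF M]) simp
  also have "\<dots> = (\<Sum>j<Suc ?k. of_bool (0 = j) * cofactor M 0 j)"
    by (rule sum.cong) (use Suc.prems(2) in auto)
  also have "\<dots> = (\<Sum>j\<in>{0}. of_bool (0 = j) * cofactor M 0 j)"
    by (rule sum.mono_neutral_right) auto
  also have "\<dots> = det (mat_delete M 0 0)"
    by (simp add: cofactor_def)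
  also have "\<dots> = det (mat m m (\<lambda>(i, j). mat_delete M 0 0 $$ (n + i, n + j)))"
    by (rule Suc.IH) (use M Suc.prems(2) in \<open>auto simp: mat_delete_def\<close>)
  also have "mat m m (\<lambda>(i, j). mat_delete M 0 0 $$ (n + i, n + j)) =
      mat m m (\<lambda>(i, j). M $$ (Suc n + i, Suc n + j))"
    by (rule eq_matI) (use M in \<open>auto simp: mat_delete_def\<close>)
  finally show ?case .
qed

text \<open>
  Square matrices are indexed by the entries of a list, so that vertices and arrows themselves serve as
  row and column indices. The order of the list affects the matrix but, by \<open>det_family_mat_reorder\<close>,
  not its determinant.
\<close>

definition family_mat :: "'i list \<Rightarrow> ('i \<Rightarrow> 'i \<Rightarrow> 'a) \<Rightarrow> 'a mat" where
  "family_mat xs f = mat (length xs) (length xs) (\<lambda>(i, j). f (xs ! i) (xs ! j))"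

lemma family_mat_carrier [simp]: "family_mat xs f \<in> carrier_mat (length xs) (length xs)"
  by (simp add: family_mat_def)

lemma family_mat_cong:
  assumes "\<And>a b. a \<in> set xs \<Longrightarrow> b \<in> set xs \<Longrightarrow> f a b = g a b"
  shows "family_mat xs f = family_mat xs g"
  unfolding family_mat_def by (rule eq_matI) (use assms in auto)

lemma family_mat_mult:
  fixes f g :: "'i \<Rightarrow> 'i \<Rightarrow> 'a::comm_ring_1"
  assumes "distinct xs"
  shows "family_mat xs f * family_mat xs g = family_mat xs (\<lambda>a b. \<Sum>c\<in>set xs. f a c * g c b)"
proof (rule eq_matI)
  fix i j assume "i < dim_row (family_mat xs (\<lambda>a b. \<Sum>c\<in>set xs. f a c * g c b))"
    "j < dim_col (family_mat xs (\<lambda>a b. \<Sum>c\<in>set xs. f a c * g c b))"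
  then have ij: "i < length xs" "j < length xs" by (simp_all add: family_mat_def)
  then have "(family_mat xs f * family_mat xs g) $$ (i, j) =
      (\<Sum>k<length xs. f (xs ! i) (xs ! k) * g (xs ! k) (xs ! j))"
    by (simp add: family_mat_def scalar_prod_def atLeast0LessThan)
  also have "\<dots> = (\<Sum>c\<in>set xs. f (xs ! i) c * g c (xs ! j))"
    by (rule sum.reindex_bij_betw[OF bij_betw_nth]) (use assms in auto)
  finally show "(family_mat xs f * family_mat xs g) $$ (i, j) =
      family_mat xs (\<lambda>a b. \<Sum>c\<in>set xs. f a c * g c b) $$ (i, j)"
    using ij by (simp add: family_mat_def)
qed (simp_all add: family_mat_def)

text \<open>
  The block triangular matrix with diagonal blocks \<open>A\<close>, \<open>D\<close> and lower block \<open>C\<close> is the product of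
  \<open>(A, 0; C, 1)\<close> and \<open>(1, 0; 0, D)\<close>. This factorisation needs no division, so the formula holds over an
  arbitrary commutative ring, in particular over a ring of power series.
\<close>

lemma det_family_mat_append:
  fixes f :: "'i \<Rightarrow> 'i \<Rightarrow> 'a::comm_ring_1"
  assumes "\<And>a b. a \<in> set xs \<Longrightarrow> b \<in> set ys \<Longrightarrow> f a b = 0"
  shows "det (family_mat (xs @ ys) f) = det (family_mat xs f) * det (family_mat ys f)"
proof -
  let ?n = "length xs" and ?m = "length ys"
  let ?O = "0\<^sub>m ?n ?m :: 'a mat"
  let ?C = "mat ?m ?n (\<lambda>(i, j). f (ys ! i) (xs ! j))"
  let ?L = "four_block_mat (family_mat xs f) ?O ?C (1\<^sub>m ?m)"
  let ?R = "four_block_mat (1\<^sub>m ?n) ?O (0\<^sub>m ?m ?n) (family_mat ys f)"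
  have "?L * ?R = four_block_mat (family_mat xs f * 1\<^sub>m ?n + ?O * 0\<^sub>m ?m ?n)
      (family_mat xs f * ?O + ?O * family_mat ys f) (?C * 1\<^sub>m ?n + 1\<^sub>m ?m * 0\<^sub>m ?m ?n)
      (?C * ?O + 1\<^sub>m ?m * family_mat ys f)"
    by (rule mult_four_block_mat[of _ ?n ?n _ ?m _ ?m _ _ ?n _ ?m]) auto
  also have "\<dots> = four_block_mat (family_mat xs f) ?O ?C (family_mat ys f)"
    by (simp add: right_mult_one_mat[OF family_mat_carrier] left_mult_one_mat[OF family_mat_carrier]
        right_mult_zero_mat[OF family_mat_carrier] left_mult_zero_mat[OF family_mat_carrier]
        right_add_zero_mat[OF family_mat_carrier] left_add_zero_mat[OF family_mat_carrier])
  also have "\<dots> = family_mat (xs @ ys) f"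
    by (rule eq_matI) (use assms in \<open>auto simp: family_mat_def nth_append\<close>)
  finally have "det (family_mat (xs @ ys) f) = det (?L * ?R)" by simp
  also have "\<dots> = det ?L * det ?R"
    by (rule det_mult[where n = "?n + ?m"]) auto
  also have "det ?L = det (mat ?n ?n (\<lambda>(i, j). ?L $$ (i, j)))"
    by (rule det_unit_columns[where m = ?m]) (auto simp: family_mat_def)
  also have "mat ?n ?n (\<lambda>(i, j). ?L $$ (i, j)) = family_mat xs f"
    by (rule eq_matI) (auto simp: family_mat_def)
  also have "det ?R = det (mat ?m ?m (\<lambda>(i, j). ?R $$ (?n + i, ?n + j)))"
    by (rule det_unit_rows) (auto simp: family_mat_def)
  also have "mat ?m ?m (\<lambda>(i, j). ?R $$ (?n + i, ?n + j)) = family_mat ys f"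
    by (rule eq_matI) (auto simp: family_mat_def)
  finally show ?thesis .
qed

lemma family_mat_map:
  "family_mat (map h xs) f = family_mat xs (\<lambda>a b. f (h a) (h b))"
  unfolding family_mat_def by (rule eq_matI) auto

text \<open>
  Sylvester's identity \<open>det (1 + F G) = det (1 + G F)\<close> for rectangular \<open>F\<close> and \<open>G\<close>. With
  \<open>U = (1, F; 0, 1)\<close> and \<open>M = (1, -F; G, 1)\<close> both \<open>U M\<close> and \<open>M U\<close> are block lower triangular, with
  diagonal blocks \<open>1 + F G, 1\<close> and \<open>1, 1 + G F\<close>; their determinants agree because
  \<open>det U det M = det M det U\<close>. The disjoint sum of the two index types carries the block matrices.
\<close>

lemma sylvester_det:
  fixes f :: "'i \<Rightarrow> 'j \<Rightarrow> 'a::comm_ring_1" and g :: "'j \<Rightarrow> 'i \<Rightarrow> 'a"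
  assumes "distinct xs" "distinct ys"
  shows "det (family_mat xs (\<lambda>a b. of_bool (a = b) + (\<Sum>c\<in>set ys. f a c * g c b))) =
    det (family_mat ys (\<lambda>c d. of_bool (c = d) + (\<Sum>a\<in>set xs. g c a * f a d)))"
proof -
  define zs where "zs = map Inl xs @ map Inr ys"
  define U where "U = (\<lambda>x y. case (x, y) of
      (Inl a, Inr d) \<Rightarrow> f a d | _ \<Rightarrow> of_bool (x = y))"
  define M where "M = (\<lambda>x y. case (x, y) of
      (Inl a, Inr d) \<Rightarrow> - f a d | (Inr c, Inl b) \<Rightarrow> g c b | _ \<Rightarrow> of_bool (x = y))"
  have zs: "distinct zs" using assms by (auto simp: zs_def distinct_map)
  have Inl_Inr: "Inl ` set xs \<inter> Inr ` set ys = {}" by auto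
  have sum_zs: "(\<Sum>z\<in>set zs. h z) = (\<Sum>a\<in>set xs. h (Inl a)) + (\<Sum>c\<in>set ys. h (Inr c))"
    for h :: "'i + 'j \<Rightarrow> 'a"
    by (simp add: zs_def sum.union_disjoint[OF _ _ Inl_Inr] sum.reindex)
  have delta1: "(\<Sum>x\<in>set us. of_bool (a = x) * h x) = h a" if "a \<in> set us"
    for a :: 'u and us and h :: "'u \<Rightarrow> 'a"
  proof -
    have "(\<Sum>x\<in>set us. of_bool (a = x) * h x) = (\<Sum>x\<in>{a}. of_bool (a = x) * h x)"
      by (rule sum.mono_neutral_right) (use that in auto)
    then show ?thesis by simp
  qed
  have delta2: "(\<Sum>x\<in>set us. h x * of_bool (x = a)) = h a" if "a \<in> set us"
    for a :: 'u and us and h :: "'u \<Rightarrow> 'a"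
  proof -
    have "(\<Sum>x\<in>set us. h x * of_bool (x = a)) = (\<Sum>x\<in>{a}. h x * of_bool (x = a))"
      by (rule sum.mono_neutral_right) (use that in auto)
    then show ?thesis by simp
  qed
  let ?UM = "\<lambda>x y. \<Sum>z\<in>set zs. U x z * M z y" and ?MU = "\<lambda>x y. \<Sum>z\<in>set zs. M x z * U z y"
  have "det (family_mat zs ?UM) = det (family_mat zs U) * det (family_mat zs M)"
    unfolding family_mat_mult[OF zs, of U M, symmetric]
    by (rule det_mult[OF family_mat_carrier family_mat_carrier])
  also have "\<dots> = det (family_mat zs M) * det (family_mat zs U)" by (rule mult.commute)
  also have "\<dots> = det (family_mat zs ?MU)"
    unfolding family_mat_mult[OF zs, of M U, symmetric]
    by (rule det_mult[OF family_mat_carrier family_mat_carrier, symmetric])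
  finally have eq: "det (family_mat zs ?UM) = det (family_mat zs ?MU)" .

  have one: "det (family_mat us (\<lambda>a b. of_bool (a = b) :: 'a)) = 1" if "distinct us" for us :: "'u list"
  proof -
    have "family_mat us (\<lambda>a b. of_bool (a = b) :: 'a) = 1\<^sub>m (length us)"
      by (rule eq_matI) (use that in \<open>auto simp: family_mat_def nth_eq_iff_index_eq\<close>)
    then show ?thesis by simp
  qed
  have "det (family_mat (map Inl xs @ map Inr ys) ?UM) =
      det (family_mat (map Inl xs) ?UM) * det (family_mat (map Inr ys) ?UM)"
    by (rule det_family_mat_append)
      (auto simp: sum_zs U_def M_def delta1 delta2 sum_negf)
  also have "family_mat (map Inl xs) ?UM =
      family_mat xs (\<lambda>a b. of_bool (a = b) + (\<Sum>c\<in>set ys. f a c * g c b))"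
    unfolding family_mat_map
    by (rule family_mat_cong) (auto simp: sum_zs U_def M_def delta1)
  also have "family_mat (map Inr ys) ?UM = family_mat ys (\<lambda>c d. of_bool (c = d))"
    unfolding family_mat_map
    by (rule family_mat_cong) (auto simp: sum_zs U_def M_def delta1)
  finally have L: "det (family_mat zs ?UM) =
      det (family_mat xs (\<lambda>a b. of_bool (a = b) + (\<Sum>c\<in>set ys. f a c * g c b)))"
    using one[OF assms(2)] by (simp add: zs_def)
  have "det (family_mat (map Inl xs @ map Inr ys) ?MU) =
      det (family_mat (map Inl xs) ?MU) * det (family_mat (map Inr ys) ?MU)"
    by (rule det_family_mat_append)
      (auto simp: sum_zs U_def M_def delta1 delta2 sum_negf)
  also have "family_mat (map Inl xs) ?MU = family_mat xs (\<lambda>a b. of_bool (a = b))"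
    unfolding family_mat_map
    by (rule family_mat_cong) (auto simp: sum_zs U_def M_def delta1)
  also have "family_mat (map Inr ys) ?MU =
      family_mat ys (\<lambda>c d. of_bool (c = d) + (\<Sum>a\<in>set xs. g c a * f a d))"
    unfolding family_mat_map
    by (rule family_mat_cong) (auto simp: sum_zs U_def M_def delta1 add.commute)
  finally have R: "det (family_mat zs ?MU) =
      det (family_mat ys (\<lambda>c d. of_bool (c = d) + (\<Sum>a\<in>set xs. g c a * f a d)))"
    using one[OF assms(1)] by (simp add: zs_def)
  show ?thesis using L R eq by simp
qed

text \<open>
  Sylvester's identity with \<open>F = f - 1\<close> and \<open>G\<close> the permutation matrix between the two enumerations.
\<close>

lemma det_family_mat_reorder:
  fixes f :: "'i \<Rightarrow> 'i \<Rightarrow> 'a::comm_ring_1"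
  assumes "distinct xs" "distinct ys" "set xs = set ys"
  shows "det (family_mat xs f) = det (family_mat ys f)"
proof -
  let ?g = "\<lambda>a b. f a b - of_bool (a = b)"
  have 1: "(\<Sum>c\<in>set ys. h c * of_bool (c = b)) = h b" if "b \<in> set ys"
    for b and h :: "'i \<Rightarrow> 'a"
  proof -
    have "(\<Sum>c\<in>set ys. h c * of_bool (c = b)) = (\<Sum>c\<in>{b}. h c * of_bool (c = b))"
      by (rule sum.mono_neutral_right) (use that in auto)
    then show ?thesis by simp
  qed
  have 2: "(\<Sum>a\<in>set xs. of_bool (c = a) * h a) = h c" if "c \<in> set xs"
    for c and h :: "'i \<Rightarrow> 'a"
  proof -
    have "(\<Sum>a\<in>set xs. of_bool (c = a) * h a) = (\<Sum>a\<in>{c}. of_bool (c = a) * h a)"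
      by (rule sum.mono_neutral_right) (use that in auto)
    then show ?thesis by simp
  qed
  have "family_mat xs f =
      family_mat xs (\<lambda>a b. of_bool (a = b) + (\<Sum>c\<in>set ys. ?g a c * of_bool (c = b)))"
    by (rule family_mat_cong) (use assms(3) in \<open>simp add: 1\<close>)
  moreover have "family_mat ys f =
      family_mat ys (\<lambda>c d. of_bool (c = d) + (\<Sum>a\<in>set xs. of_bool (c = a) * ?g a d))"
    by (rule family_mat_cong) (use assms(3) in \<open>simp add: 2\<close>)
  ultimately show ?thesis
    using sylvester_det[OF assms(1,2), of ?g "\<lambda>c b. of_bool (c = b)"] by (simp only:)
qed

section \<open>Determinants of weighted partial bijections\<close>

text \<open>
  Expansion along the first column. The minor of the entry \<open>1\<close> is unitriangular, and the minor of the
  last entry \<open>z (l - 1)\<close> is triangular with the remaining \<open>z i\<close> on its diagonal. For \<open>l = 1\<close> the two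
  entries fall together.
\<close>

lemma det_cyclic_mat:
  fixes z :: "nat \<Rightarrow> 'a::comm_ring_1"
  assumes "l > 0"
  shows "det (mat l l (\<lambda>(i, j). of_bool (i = j) + of_bool (j = Suc i mod l) * z i)) =
    1 - (-1) ^ l * (\<Prod>i<l. z i)"
proof (cases "l = 1")
  case True
  then show ?thesis by (simp add: det_single)
next
  case False
  with assms obtain n where n: "l = Suc n" "n > 0" by (cases l) auto
  let ?M = "mat l l (\<lambda>(i, j). of_bool (i = j) + of_bool (j = Suc i mod l) * z i)"
  have "det ?M = (\<Sum>i<l. ?M $$ (i, 0) * cofactor ?M i 0)"
    by (rule laplace_expansion_column[where n = l]) (use assms in auto)
  also have "\<dots> = (\<Sum>i\<in>{0, n}. ?M $$ (i, 0) * cofactor ?M i 0)"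
    by (rule sum.mono_neutral_right) (use n in \<open>auto simp: mod_Suc split: if_splits\<close>)
  also have "\<dots> = cofactor ?M 0 0 + z n * cofactor ?M n 0"
    using n by simp
  also have "cofactor ?M 0 0 = 1"
  proof -
    have "upper_triangular (mat_delete ?M 0 0)"
      by (rule upper_triangularI) (use n in \<open>auto simp: mat_delete_def mod_Suc\<close>)
    moreover have "mat_delete ?M 0 0 \<in> carrier_mat n n"
      using n by (simp add: mat_delete_def)
    ultimately have "det (mat_delete ?M 0 0) = prod_list (diag_mat (mat_delete ?M 0 0))"
      by (rule det_upper_triangular)
    also have "\<dots> = 1"
      unfolding prod_list_diag_prod
      by (rule prod.neutral) (use n in \<open>auto simp: mat_delete_def mod_Suc\<close>)
    finally show ?thesis by (simp add: cofactor_def)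
  qed
  also have "cofactor ?M n 0 = (-1) ^ n * (\<Prod>i<n. z i)"
  proof -
    have "det (mat_delete ?M n 0) = prod_list (diag_mat (mat_delete ?M n 0))"
      by (rule det_lower_triangular[where n = n])
         (use n in \<open>auto simp: mat_delete_def mod_Suc\<close>)
    also have "\<dots> = (\<Prod>i<n. z i)"
      unfolding prod_list_diag_prod
      by (rule prod.cong) (use n in \<open>auto simp: mat_delete_def mod_Suc\<close>)
    finally show ?thesis by (simp add: cofactor_def)
  qed
  finally show ?thesis using n by (simp add: mult_ac)
qed

text \<open>
  For the relations \<open>r\<close> ``the product \<open>ab\<close> of composable arrows is zero'' and ``is non-zero'' these are the
  minimal oriented cycles with full relations and with no relations.
\<close>

definition cyclic_list :: "('e \<Rightarrow> 'e \<Rightarrow> bool) \<Rightarrow> 'e list \<Rightarrow> bool" where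
  "cyclic_list r C \<longleftrightarrow>
     C \<noteq> [] \<and> distinct C \<and> (\<forall>i<length C. r (C ! i) (C ! (Suc i mod length C)))"

lemma cyclic_listD:
  assumes "cyclic_list r C"
  shows "C \<noteq> []" "distinct C" "i < length C \<Longrightarrow> r (C ! i) (C ! (Suc i mod length C))"
  using assms by (auto simp: cyclic_list_def)

lemma cyclic_list_rotate:
  assumes "cyclic_list r C"
  shows "cyclic_list r (rotate n C)"
  unfolding cyclic_list_def
proof (intro conjI allI impI)
  fix i assume "i < length (rotate n C)"
  then have i: "i < length C" by simp
  then have pos: "0 < length C" by linarith
  have "rotate n C ! i = C ! ((n + i) mod length C)"
    using i by (rule nth_rotate)
  moreover have "rotate n C ! (Suc i mod length C) = C ! (Suc ((n + i) mod length C) mod length C)"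
    using pos by (subst nth_rotate) (simp_all add: mod_simps del: length_greater_0_conv)
  moreover have "(n + i) mod length C < length C"
    using pos by (rule mod_less_divisor)
  ultimately show "r (rotate n C ! i) (rotate n C ! (Suc i mod length (rotate n C)))"
    using cyclic_listD(3)[OF assms] by simp
qed (use cyclic_listD[OF assms] in auto)

context
  fixes r :: "'e \<Rightarrow> 'e \<Rightarrow> bool"
  assumes r_unique: "\<And>a b b'. r a b \<Longrightarrow> r a b' \<Longrightarrow> b = b'"
begin

lemma cyclic_list_nth:
  assumes C: "cyclic_list r C" and D: "cyclic_list r D" and hd: "C ! 0 = D ! 0"
    and i: "i < length D"
  shows "D ! i = C ! (i mod length C)"
  using i
proof (induction i)
  case 0
  then show ?case using hd by simp
next
  case (Suc i)
  have "r (D ! i) (D ! Suc i)"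
    using cyclic_listD(3)[OF D, of i] Suc.prems by simp
  moreover have "r (C ! (i mod length C)) (C ! (Suc i mod length C))"
    using cyclic_listD(3)[OF C, of "i mod length C"] cyclic_listD(1)[OF C] by (simp add: mod_simps)
  ultimately show ?case using Suc r_unique by simp
qed

lemma cyclic_list_length_le:
  assumes C: "cyclic_list r C" and D: "cyclic_list r D" and hd: "C ! 0 = D ! 0"
  shows "length D \<le> length C"
proof (rule ccontr)
  assume "\<not> length D \<le> length C"
  then have less: "length C < length D" by simp
  then have "D ! length C = D ! 0"
    using cyclic_list_nth[OF C D hd less] hd by simp
  then show False
    using less cyclic_listD(2)[OF D] cyclic_listD(1)[OF C]
    by (metis length_greater_0_conv less_trans nth_eq_iff_index_eq less_irrefl)
qed

lemma cyclic_list_eqI: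
  assumes C: "cyclic_list r C" and D: "cyclic_list r D" and hd: "C ! 0 = D ! 0"
  shows "C = D"
proof (rule nth_equalityI)
  show len: "length C = length D"
    using cyclic_list_length_le[OF C D hd] cyclic_list_length_le[OF D C hd[symmetric]] by simp
  fix i assume "i < length C"
  then show "C ! i = D ! i"
    using cyclic_list_nth[OF C D hd, of i] len by simp
qed

text \<open>
  Rotated so as to begin at a common element, two cyclic lists agree, because each entry determines the
  next one. Hence cycles from different rotation classes are disjoint.
\<close>

lemma cyclic_lists_meet:
  assumes C: "cyclic_list r C" and D: "cyclic_list r D" and x: "x \<in> set C" "x \<in> set D"
  shows "(C, D) \<in> rotation"
proof -
  obtain i j where i: "i < length C" "C ! i = x" and j: "j < length D" "D ! j = x"
    using x by (auto simp: in_set_conv_nth)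
  have "rotate i C = rotate j D"
  proof (rule cyclic_list_eqI)
    show "rotate i C ! 0 = rotate j D ! 0"
      using i j nth_rotate[of 0 C i] nth_rotate[of 0 D j] by fastforce
  qed (rule cyclic_list_rotate[OF C], rule cyclic_list_rotate[OF D])
  moreover have "(C, rotate i C) \<in> rotation" "(D, rotate j D) \<in> rotation"
    by (auto simp: rotation_def)
  ultimately show ?thesis
    using equiv_rotation by (metis equivE symE transE)
qed

lemma det_cyclic_list:
  fixes y :: "'e \<Rightarrow> 'a::comm_ring_1"
  assumes C: "cyclic_list r C"
  shows "det (family_mat C (\<lambda>a b. of_bool (a = b) + of_bool (r a b) * y a)) =
    1 - (-1) ^ length C * path_weight y C"
proof -
  let ?l = "length C"
  have r_iff: "r (C ! i) (C ! j) \<longleftrightarrow> j = Suc i mod ?l" if "i < ?l" "j < ?l" for i j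
  proof
    assume "r (C ! i) (C ! j)"
    then have "C ! j = C ! (Suc i mod ?l)"
      using cyclic_listD(3)[OF C that(1)] r_unique by blast
    moreover have "Suc i mod ?l < ?l" using that(1) by (intro mod_less_divisor) linarith
    ultimately show "j = Suc i mod ?l"
      using that(2) cyclic_listD(2)[OF C] nth_eq_iff_index_eq by blast
  qed (use cyclic_listD(3)[OF C that(1)] in simp)
  have "family_mat C (\<lambda>a b. of_bool (a = b) + of_bool (r a b) * y a) =
      mat ?l ?l (\<lambda>(i, j). of_bool (i = j) + of_bool (j = Suc i mod ?l) * y (C ! i))"
    by (rule eq_matI)
       (use cyclic_listD(2)[OF C] in \<open>auto simp: family_mat_def r_iff nth_eq_iff_index_eq\<close>)
  also have "det \<dots> = 1 - (-1) ^ ?l * (\<Prod>i<?l. y (C ! i))"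
    by (rule det_cyclic_mat) (use cyclic_listD(1)[OF C] in simp)
  also have "(\<Prod>i<?l. y (C ! i)) = path_weight y C"
    by (simp add: path_weight_def prod.list_conv_set_nth atLeast0LessThan)
  finally show ?thesis .
qed

end

text \<open>
  Iterating the successor function from any point of \<open>E\<close> must repeat a value, and by injectivity the
  starting point is the first value to recur.
\<close>

lemma cyclic_list_exists:
  assumes r_unique: "\<And>a b b'. r a b \<Longrightarrow> r a b' \<Longrightarrow> b = b'"
    and r_inj: "\<And>a a' b. r a b \<Longrightarrow> r a' b \<Longrightarrow> a = a'"
    and fin: "finite E" and a: "a \<in> E" and total: "\<And>x. x \<in> E \<Longrightarrow> \<exists>y\<in>E. r x y"
  shows "\<exists>C. cyclic_list r C \<and> set C \<subseteq> E"
proof -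
  obtain f where f: "\<And>x. x \<in> E \<Longrightarrow> f x \<in> E \<and> r x (f x)" using total by metis
  have mem: "(f ^^ n) a \<in> E" for n by (induction n) (use a f in auto)
  have inj: "x = x'" if "x \<in> E" "x' \<in> E" "f x = f x'" for x x'
    using that f r_inj by metis
  have cancel: "(f ^^ (n - m)) a = a" if "(f ^^ m) a = (f ^^ n) a" "m \<le> n" for m n
    using that
  proof (induction m arbitrary: n)
    case (Suc m)
    then obtain n' where n': "n = Suc n'" by (cases n) auto
    then have "(f ^^ m) a = (f ^^ n') a" using Suc.prems inj mem by simp
    then show ?case using Suc n' by simp
  qed simp
  have "\<not> inj (\<lambda>n. (f ^^ n) a)"
    using fin mem finite_subset[of "range (\<lambda>n. (f ^^ n) a)" E] finite_imageD by blast
  then obtain m n where "m < n" "(f ^^ m) a = (f ^^ n) a"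
    unfolding inj_def by (metis linorder_neqE_nat)
  then have ex: "\<exists>k>0. (f ^^ k) a = a" using cancel[of m n] by (intro exI[of _ "n - m"]) simp
  define k where "k = (LEAST k. k > 0 \<and> (f ^^ k) a = a)"
  have k: "k > 0" "(f ^^ k) a = a" using LeastI_ex[OF ex] by (auto simp: k_def)
  have min: "\<not> (0 < j \<and> (f ^^ j) a = a)" if "j < k" for j
    using not_less_Least that unfolding k_def by blast
  let ?C = "map (\<lambda>i. (f ^^ i) a) [0..<k]"
  have "i = j" if "i \<le> j" "j < k" "(f ^^ i) a = (f ^^ j) a" for i j
    using cancel[OF that(3,1)] min[of "j - i"] that by force
  then have "inj_on (\<lambda>i. (f ^^ i) a) {..<k}"
    by (auto simp: inj_on_def) (metis linorder_linear)
  then have "distinct ?C" by (simp add: distinct_map atLeast0LessThan)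
  moreover have "r (?C ! i) (?C ! (Suc i mod k))" if i: "i < k" for i
  proof -
    have "?C ! (Suc i mod k) = f (?C ! i)"
      using i k by (cases "Suc i = k") auto
    then show ?thesis using i f[OF mem[of i]] by simp
  qed
  ultimately have "cyclic_list r ?C" using k(1) by (simp add: cyclic_list_def)
  moreover have "set ?C \<subseteq> E" using mem by auto
  ultimately show ?thesis by blast
qed

lemma finite_cyclic_classes:
  assumes "finite E"
  shows "finite ({C. cyclic_list r C \<and> set C \<subseteq> E} // rotation)"
proof -
  have "{C. cyclic_list r C \<and> set C \<subseteq> E} \<subseteq> {C. set C \<subseteq> E \<and> distinct C}"
    by (auto simp: cyclic_list_def)
  then have "finite {C. cyclic_list r C \<and> set C \<subseteq> E}"
    by (rule finite_subset) (rule finite_subset_distinct[OF assms])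
  then show ?thesis unfolding quotient_def by simp
qed

text \<open>
  The permutations that contribute to \<open>det (1 + M)\<close>, where \<open>M\<close> is a weighted matrix of a partial
  bijection \<open>r\<close>, are the products of disjoint cycles of \<open>r\<close>; a cycle of length \<open>l\<close> has sign
  \<open>(-1) ^ (l - 1)\<close>, and summing over all sets of cycles yields the product. The proof splits off
  one piece of the index set at a time: an element without successor contributes a factor \<open>1\<close>, and a cycle
  contributes its own determinant. In both cases no element of the piece has a successor outside it, so
  the matrix is block triangular. If neither piece exists, then \<open>es\<close> is empty, since a total injective
  relation on a finite non-empty set has a cycle.
\<close>

theorem det_partial_bijection:
  fixes y :: "'e \<Rightarrow> 'a::comm_ring_1"
  assumes r_unique: "\<And>a b b'. r a b \<Longrightarrow> r a b' \<Longrightarrow> b = b'"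
    and r_inj: "\<And>a a' b. r a b \<Longrightarrow> r a' b \<Longrightarrow> a = a'"
    and "distinct es"
  shows "det (family_mat es (\<lambda>a b. of_bool (a = b) + of_bool (r a b) * y a)) =
    (\<Prod>K\<in>{C. cyclic_list r C \<and> set C \<subseteq> set es} // rotation.
       1 - (-1) ^ cycle_length K * cycle_weight y K)"
  using \<open>distinct es\<close>
proof (induction "length es" arbitrary: es rule: less_induct)
  case less
  let ?f = "\<lambda>a b. of_bool (a = b) + of_bool (r a b) * y a"
  let ?cyc = "\<lambda>E. {C. cyclic_list r C \<and> set C \<subseteq> E}"
  let ?g = "\<lambda>K. 1 - (-1) ^ cycle_length K * cycle_weight y K"
  consider "es = []" | a where "a \<in> set es" "\<And>b. b \<in> set es \<Longrightarrow> \<not> r a b" |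
    D where "cyclic_list r D" "set D \<subseteq> set es"
  proof -
    consider "es = []" | "\<exists>a\<in>set es. \<forall>b\<in>set es. \<not> r a b" |
      "es \<noteq> []" "\<And>a. a \<in> set es \<Longrightarrow> \<exists>b\<in>set es. r a b" by blast
    then show ?thesis
    proof cases
      case 3
      then have "\<exists>C. cyclic_list r C \<and> set C \<subseteq> set es"
        using cyclic_list_exists[OF r_unique r_inj, where E = "set es" and a = "hd es"] by auto
      then show ?thesis using that(3) by blast
    qed (use that in blast)+
  qed
  then show ?case
  proof cases
    case 1
    then have "?cyc (set es) = {}" by (auto simp: cyclic_list_def)
    then have "?cyc (set es) // rotation = {}" by (simp only: quotient_empty)
    moreover have "det (family_mat es ?f) = 1" using 1 by (simp add: family_mat_def)
    ultimately show ?thesis by (simp only: prod.empty)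
  next
    case (2 a)
    let ?fs = "remove1 a es"
    have es: "distinct ?fs" "set es = insert a (set ?fs)" "a \<notin> set ?fs"
      using less.prems 2(1) by auto
    have len: "length ?fs < length es"
      using 2(1) length_pos_if_in_set[OF 2(1)] by (simp add: length_remove1)
    have "det (family_mat es ?f) = det (family_mat ([a] @ ?fs) ?f)"
      by (rule det_family_mat_reorder) (use less.prems es in auto)
    also have "\<dots> = det (family_mat [a] ?f) * det (family_mat ?fs ?f)"
      by (rule det_family_mat_append) (use 2 es in auto)
    also have "det (family_mat [a] ?f) = 1"
      using 2 by (simp add: family_mat_def det_single)
    also have "det (family_mat ?fs ?f) = (\<Prod>K\<in>?cyc (set ?fs) // rotation. ?g K)"
      by (rule less.hyps[OF len es(1)])
    also have "?cyc (set ?fs) = ?cyc (set es)"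
    proof -
      have "a \<notin> set C" if C: "cyclic_list r C" "set C \<subseteq> set es" for C
      proof
        assume "a \<in> set C"
        then obtain i where i: "i < length C" "C ! i = a" by (auto simp: in_set_conv_nth)
        then have "C ! (Suc i mod length C) \<in> set C"
          by (intro nth_mem mod_less_divisor) linarith
        then show False using cyclic_listD(3)[OF C(1) i(1)] i C 2(2) by auto
      qed
      then have "set C \<subseteq> set ?fs" if "cyclic_list r C" "set C \<subseteq> set es" for C
        using that by (metis in_set_remove1 subsetD subsetI)
      moreover have "set ?fs \<subseteq> set es" by (rule set_remove1_subset)
      ultimately show ?thesis by (intro Collect_cong conj_cong refl) (metis subset_trans)
    qed
    finally show ?thesis by simp
  next
    case (3 D)
    let ?fs = "filter (\<lambda>x. x \<notin> set D) es"
    have D: "D \<noteq> []" "distinct D" using cyclic_listD[OF 3(1)] by auto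
    have es: "distinct ?fs" "set es = set D \<union> set ?fs"
      using less.prems 3(2) by auto
    have len: "length ?fs < length es"
      by (rule length_filter_less[of "hd D"]) (use D 3(2) in auto)
    \<comment> \<open>A cycle already contains the unique successor of each of its elements.\<close>
    have succ: "b \<in> set D" if "a \<in> set D" "r a b" for a b
    proof -
      obtain i where i: "i < length D" "D ! i = a" using \<open>a \<in> set D\<close> by (auto simp: in_set_conv_nth)
      then have "b = D ! (Suc i mod length D)"
        using cyclic_listD(3)[OF 3(1) i(1)] r_unique \<open>r a b\<close> by blast
      then show ?thesis using i by (auto intro!: nth_mem mod_less_divisor)
    qed
    have "det (family_mat es ?f) = det (family_mat (D @ ?fs) ?f)"
      by (rule det_family_mat_reorder) (use less.prems D 3(2) in auto)
    also have "\<dots> = det (family_mat D ?f) * det (family_mat ?fs ?f)"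
      by (rule det_family_mat_append) (use succ in auto)
    also have "det (family_mat D ?f) = ?g (rotation `` {D})"
      using det_cyclic_list[OF r_unique 3(1)] by (simp add: cycle_length_class cycle_weight_class)
    also have "det (family_mat ?fs ?f) = (\<Prod>K\<in>?cyc (set ?fs) // rotation. ?g K)"
      by (rule less.hyps[OF len es(1)])
    also have "?g (rotation `` {D}) * \<dots> =
        (\<Prod>K\<in>insert (rotation `` {D}) (?cyc (set ?fs) // rotation). ?g K)"
    proof (rule prod.insert[symmetric])
      show "finite (?cyc (set ?fs) // rotation)" by (rule finite_cyclic_classes) simp
      show "rotation `` {D} \<notin> ?cyc (set ?fs) // rotation"
      proof
        assume "rotation `` {D} \<in> ?cyc (set ?fs) // rotation"
        then obtain C where C: "cyclic_list r C" "set C \<subseteq> set ?fs"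
          "rotation `` {D} = rotation `` {C}" by (auto simp: quotient_def)
        then have "(D, C) \<in> rotation"
          using eq_equiv_class_iff[OF equiv_rotation] by blast
        then have "set C = set D" by (auto simp: rotation_def)
        then show False using C(2) D(1) by (cases D) auto
      qed
    qed
    also have "insert (rotation `` {D}) (?cyc (set ?fs) // rotation) = ?cyc (set es) // rotation"
    proof (intro equalityI subsetI)
      fix K assume "K \<in> insert (rotation `` {D}) (?cyc (set ?fs) // rotation)"
      then consider "K = rotation `` {D}" | C where "K = rotation `` {C}" "C \<in> ?cyc (set ?fs)"
        by (auto elim: quotientE)
      then show "K \<in> ?cyc (set es) // rotation"
      proof cases
        case 1
        show ?thesis unfolding 1 by (rule quotientI) (use 3 in simp)
      next
        case (2 C)
        show ?thesis unfolding 2(1) by (rule quotientI) (use 2(2) in auto)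
      qed
    next
      fix K assume "K \<in> ?cyc (set es) // rotation"
      then obtain C where K: "K = rotation `` {C}" and "C \<in> ?cyc (set es)" by (rule quotientE)
      then have C: "cyclic_list r C" "set C \<subseteq> set es" by simp_all
      show "K \<in> insert (rotation `` {D}) (?cyc (set ?fs) // rotation)"
      proof (cases "set C \<inter> set D = {}")
        case True
        then have "C \<in> ?cyc (set ?fs)" using C by auto
        then show ?thesis unfolding K by (intro insertI2 quotientI)
      next
        case False
        then obtain x where x: "x \<in> set C" "x \<in> set D" by blast
        have "(C, D) \<in> rotation"
          by (rule cyclic_lists_meet[OF r_unique C(1) 3(1) x])
        then have "K = rotation `` {D}" unfolding K by (rule equiv_class_eq[OF equiv_rotation])
        then show ?thesis by (rule ssubst) (rule insertI1)
      qed
    qed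
    finally show ?thesis .
  qed
qed

section \<open>Generating functions of paths\<close>

text \<open>
  The generating function of a set of words in the arrows, counted by their multisets of letters. Disjoint
  unions become sums and prefixing a letter becomes multiplication by its indeterminate, which turns
  decompositions of sets of paths into linear equations.
\<close>

definition walk_series :: "'e list set \<Rightarrow> ('e, 'a::comm_ring_1) mfps" where
  "walk_series S = mfps_sum (path_weight mfps_X) S"

lemma mfps_coeff_walk_series:
  "mfps_coeff (walk_series S) m = of_nat (card {p \<in> S. mset p = m})"
  by (auto simp: walk_series_def mfps_sum_def mfps_coeff_path_weight_X
           intro!: arg_cong[where f = card] arg_cong[where f = of_nat])

lemma walk_series_empty [simp]: "walk_series {} = 0"
  by (rule mfps_eqI) (simp add: mfps_coeff_walk_series zero_mfps_def)

lemma walk_series_Nil [simp]: "walk_series {[]} = (1 :: ('e, 'a::comm_ring_1) mfps)"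
proof (rule mfps_eqI)
  fix m :: "'e multiset"
  have "{p \<in> {[]}. mset p = m} = (if m = {#} then {[]} else {})" by auto
  then show "mfps_coeff (walk_series {[]} :: ('e, 'a) mfps) m = mfps_coeff 1 m"
    by (simp add: mfps_coeff_walk_series one_mfps_def)
qed

lemma walk_series_Un:
  assumes "S \<inter> T = {}"
  shows "walk_series (S \<union> T) = walk_series S + walk_series T"
proof (rule mfps_eqI)
  fix m
  have "{p \<in> S \<union> T. mset p = m} = {p \<in> S. mset p = m} \<union> {p \<in> T. mset p = m}" by auto
  also have "card \<dots> = card {p \<in> S. mset p = m} + card {p \<in> T. mset p = m}"
    by (rule card_Un_disjoint) (use assms finite_mset_fibre in auto)
  finally show "mfps_coeff (walk_series (S \<union> T)) m = mfps_coeff (walk_series S + walk_series T) m"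
    by (simp add: mfps_coeff_walk_series plus_mfps_def)
qed

lemma walk_series_UN:
  assumes "finite A" "\<And>i j. i \<in> A \<Longrightarrow> j \<in> A \<Longrightarrow> i \<noteq> j \<Longrightarrow> T i \<inter> T j = {}"
  shows "walk_series (\<Union>i\<in>A. T i) = (\<Sum>i\<in>A. walk_series (T i))"
  using assms
proof (induction A rule: finite_induct)
  case (insert i A)
  have "T i \<inter> (\<Union>j\<in>A. T j) = {}"
    using insert.prems insert.hyps(2) by blast
  then show ?case using insert by (simp add: walk_series_Un)
qed simp

lemma mfps_coeff_monom_mult:
  "mfps_coeff (path_weight mfps_X p * f) m =
    (if mset p \<subseteq># m then mfps_coeff f (m - mset p) else 0)"
proof -
  have "mfps_coeff (path_weight mfps_X p * f) m =
      (\<Sum>(a, b)\<in>msplits m. if a = mset p then mfps_coeff f b else 0)"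
    unfolding times_mfps_def mfps_coeff_Abs
    by (rule sum.cong) (auto simp: mfps_coeff_path_weight_X)
  also have "\<dots> = (\<Sum>(a, b)\<in>(if mset p \<subseteq># m then {(mset p, m - mset p)} else {}).
      if a = mset p then mfps_coeff f b else 0)"
    by (rule sum.mono_neutral_right) (auto split: if_splits)
  finally show ?thesis by simp
qed

lemma walk_series_Cons:
  "walk_series ((#) a ` S) = (mfps_X a * walk_series S :: ('e, 'a::comm_ring_1) mfps)"
proof (rule mfps_eqI)
  fix m :: "'e multiset"
  have "{p \<in> (#) a ` S. mset p = m} = (if a \<in># m then (#) a ` {p \<in> S. mset p = m - {#a#}} else {})"
    by (auto simp: add_mset_remove_trivial_eq)
  then have "card {p \<in> (#) a ` S. mset p = m} = (if a \<in># m then card {p \<in> S. mset p = m - {#a#}} else 0)"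
    by (simp add: card_image)
  moreover have "mfps_coeff (mfps_X a * walk_series S :: ('e, 'a) mfps) m =
      (if a \<in># m then mfps_coeff (walk_series S) (m - {#a#}) else 0)"
    using mfps_coeff_monom_mult[of "[a]" "walk_series S :: ('e, 'a) mfps" m]
    by (simp add: path_weight_def)
  ultimately show "mfps_coeff (walk_series ((#) a ` S)) m =
      mfps_coeff (mfps_X a * walk_series S :: ('e, 'a) mfps) m"
    by (simp add: mfps_coeff_walk_series)
qed

text \<open>
  Let \<open>N\<close> and \<open>R\<close> be the 0-1 matrices of composable pairs of arrows that are allowed, respectively
  forbidden, as consecutive letters, let \<open>X\<close> be the diagonal matrix of the indeterminates, and let
  \<open>S\<close> and \<open>T\<close> be the incidence matrices of vertices with tails and of heads with vertices, so that
  \<open>T S = N + R\<close>. The series \<open>H a j\<close> of the allowed paths that begin with the arrow \<open>a\<close> and end at \<open>j\<close>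
  satisfy \<open>H = X T + X N H\<close>, and the matrix of all allowed paths is \<open>W = 1 + S H\<close>. By Sylvester's
  identity \<open>det W = det (1 + H S)\<close>, and
  \<open>(1 - X N) (1 + H S) = 1 - X N + X T S = 1 + X R\<close>.
\<close>

theorem det_walk_matrix:
  fixes Q :: "('v, 'e) pre_digraph" and N :: "'e \<Rightarrow> 'e \<Rightarrow> bool"
  defines "W \<equiv> \<lambda>i j. walk_series {p. pre_digraph.awalk Q i p j \<and> successively N p}
      :: ('e, 'a::comm_ring_1) mfps"
    and "step \<equiv> \<lambda>a b. a \<in> arcs Q \<and> b \<in> arcs Q \<and> head Q a = tail Q b"
  assumes "fin_digraph Q"
    and vs: "distinct vs" "set vs = verts Q"
    and es: "distinct es" "set es = arcs Q"
  shows "det (family_mat es (\<lambda>a b. of_bool (a = b) + of_bool (step a b \<and> N a b) * - mfps_X a)) *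
      det (family_mat vs W) =
    det (family_mat es (\<lambda>a b. of_bool (a = b) + of_bool (step a b \<and> \<not> N a b) * mfps_X a))"
proof -
  interpret fin_digraph Q by fact
  define Hset where "Hset = (\<lambda>a j. {p. p \<noteq> [] \<and> hd p = a \<and> awalk (tail Q a) p j \<and> successively N p})"
  define H :: "'e \<Rightarrow> 'v \<Rightarrow> ('e, 'a) mfps" where "H = (\<lambda>a j. walk_series (Hset a j))"
  have split: "walk_series ((if c then {[]} else {}) \<union> (\<Union>b\<in>A. Hset b j)) =
      of_bool c + (\<Sum>b\<in>A. H b j)" if "A \<subseteq> arcs Q" for A c j
  proof -
    have "finite A" using that finite_arcs by (rule finite_subset)
    have "walk_series ((if c then {[]} else {}) \<union> (\<Union>b\<in>A. Hset b j)) =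
        walk_series (if c then {[]} else {}) + walk_series (\<Union>b\<in>A. Hset b j)"
      by (rule walk_series_Un) (auto simp: Hset_def)
    also have "walk_series (\<Union>b\<in>A. Hset b j) = (\<Sum>b\<in>A. H b j)"
      unfolding H_def by (rule walk_series_UN[OF \<open>finite A\<close>]) (auto simp: Hset_def)
    finally show ?thesis by simp
  qed
  have filter_sum: "(\<Sum>b\<in>{b \<in> arcs Q. P b}. h b) = (\<Sum>b\<in>arcs Q. of_bool (P b) * h b)"
    for P and h :: "'e \<Rightarrow> ('e, 'a) mfps"
    by (rule sum.mono_neutral_cong_left) auto
  \<comment> \<open>This is \<open>H = X T + X N H\<close>: an allowed path is its first arrow, followed by nothing or by an allowed path that begins with an allowed successor.\<close>
  have H_rec: "H a j = mfps_X a * (of_bool (head Q a = j) +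
      (\<Sum>b\<in>arcs Q. of_bool (step a b \<and> N a b) * H b j))" if a: "a \<in> arcs Q" for a j
  proof -
    have "p \<in> Hset a j \<longleftrightarrow> p \<in> (#) a ` ((if head Q a = j then {[]} else {}) \<union>
        (\<Union>b\<in>{b \<in> arcs Q. step a b \<and> N a b}. Hset b j))" for p
    proof (cases p)
      case (Cons b q)
      show ?thesis unfolding Cons using a
        by (cases q) (auto simp: Hset_def awalk_Cons_iff awalk_Nil_iff successively_Cons step_def image_iff)
    qed (auto simp: Hset_def)
    then have "Hset a j = (#) a ` ((if head Q a = j then {[]} else {}) \<union>
        (\<Union>b\<in>{b \<in> arcs Q. step a b \<and> N a b}. Hset b j))" by blast
    then show ?thesis
      using split[of "{b \<in> arcs Q. step a b \<and> N a b}" "head Q a = j" j]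
      by (simp add: H_def walk_series_Cons filter_sum)
  qed
  \<comment> \<open>This is \<open>W = 1 + S H\<close>.\<close>
  have W_H: "W i j = of_bool (i = j) + (\<Sum>a\<in>arcs Q. of_bool (tail Q a = i) * H a j)"
    if i: "i \<in> verts Q" for i j
  proof -
    have "awalk i p j \<and> successively N p \<longleftrightarrow> p \<in> (if i = j then {[]} else {}) \<union>
        (\<Union>a\<in>{a \<in> arcs Q. tail Q a = i}. Hset a j)" for p
      using i by (cases p) (auto simp: Hset_def awalk_Cons_iff awalk_Nil_iff)
    then have "{p. awalk i p j \<and> successively N p} = (if i = j then {[]} else {}) \<union>
        (\<Union>a\<in>{a \<in> arcs Q. tail Q a = i}. Hset a j)" by blast
    then show ?thesis
      using split[of "{a \<in> arcs Q. tail Q a = i}" "i = j" j]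
      by (simp add: W_def filter_sum)
  qed
  have "det (family_mat vs W) =
      det (family_mat vs (\<lambda>i j. of_bool (i = j) + (\<Sum>a\<in>set es. of_bool (tail Q a = i) * H a j)))"
    by (rule arg_cong[where f = det], rule family_mat_cong) (simp add: vs es W_H)
  also have "\<dots> = det (family_mat es (\<lambda>a b. of_bool (a = b) +
      (\<Sum>i\<in>set vs. H a i * of_bool (tail Q b = i))))"
    by (rule sylvester_det) (fact vs es)+
  also have "\<dots> = det (family_mat es (\<lambda>a b. of_bool (a = b) + H a (tail Q b)))"
  proof (rule arg_cong[where f = det], rule family_mat_cong)
    fix a b assume "b \<in> set es"
    then have "(\<Sum>i\<in>set vs. H a i * of_bool (tail Q b = i)) =
        (\<Sum>i\<in>{tail Q b}. H a i * of_bool (tail Q b = i))"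
      by (intro sum.mono_neutral_right) (auto simp: vs es)
    then show "of_bool (a = b) + (\<Sum>i\<in>set vs. H a i * of_bool (tail Q b = i)) =
        of_bool (a = b) + H a (tail Q b)" by simp
  qed
  finally have W: "det (family_mat vs W) =
      det (family_mat es (\<lambda>a b. of_bool (a = b) + H a (tail Q b)))" .
  \<comment> \<open>This is \<open>(1 - X N) (1 + H S) = 1 + X R\<close>, entry by entry.\<close>
  have entry: "(\<Sum>c\<in>set es. (of_bool (a = c) + of_bool (step a c \<and> N a c) * - mfps_X a) *
      (of_bool (c = b) + H c (tail Q b))) =
      of_bool (a = b) + of_bool (step a b \<and> \<not> N a b) * mfps_X a"
    if a: "a \<in> set es" and b: "b \<in> set es" for a b
  proof -
    have "(\<Sum>c\<in>set es. of_bool (a = c) * h c) = (\<Sum>c\<in>{a}. of_bool (a = c) * h c)"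
      for h :: "'e \<Rightarrow> ('e, 'a) mfps"
      by (rule sum.mono_neutral_right) (use a in auto)
    then have 1: "(\<Sum>c\<in>set es. of_bool (a = c) * h c) = h a" for h :: "'e \<Rightarrow> ('e, 'a) mfps"
      by simp
    have "(\<Sum>c\<in>set es. h c * of_bool (c = b)) = (\<Sum>c\<in>{b}. h c * of_bool (c = b))"
      for h :: "'e \<Rightarrow> ('e, 'a) mfps"
      by (rule sum.mono_neutral_right) (use b in auto)
    then have 2: "(\<Sum>c\<in>set es. h c * of_bool (c = b)) = h b" for h :: "'e \<Rightarrow> ('e, 'a) mfps"
      by simp
    have expand: "(x + n * - y) * (d + h) = x * (d + h) - y * (n * d) - y * (n * h)"
      for x n y d h :: "('e, 'a) mfps"
      by (simp add: algebra_simps)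
    let ?n = "\<lambda>c. of_bool (step a c \<and> N a c) :: ('e, 'a) mfps"
    have "(\<Sum>c\<in>set es. (of_bool (a = c) + ?n c * - mfps_X a) * (of_bool (c = b) + H c (tail Q b))) =
        (\<Sum>c\<in>set es. of_bool (a = c) * (of_bool (c = b) + H c (tail Q b)) -
          mfps_X a * (?n c * of_bool (c = b)) - mfps_X a * (?n c * H c (tail Q b)))"
      by (rule sum.cong[OF refl], rule expand)
    also have "\<dots> = (\<Sum>c\<in>set es. of_bool (a = c) * (of_bool (c = b) + H c (tail Q b))) -
        mfps_X a * ((\<Sum>c\<in>set es. ?n c * of_bool (c = b)) + (\<Sum>c\<in>set es. ?n c * H c (tail Q b)))"
      unfolding sum_subtractf sum_distrib_left[symmetric] by (simp only: distrib_left diff_diff_eq)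
    also have "\<dots> = of_bool (a = b) + H a (tail Q b) -
        mfps_X a * (?n b + (\<Sum>c\<in>set es. ?n c * H c (tail Q b)))"
      unfolding 1 2 ..
    also have "H a (tail Q b) =
        mfps_X a * (of_bool (head Q a = tail Q b) + (\<Sum>c\<in>set es. ?n c * H c (tail Q b)))"
      using H_rec a unfolding es by blast
    also have "of_bool (head Q a = tail Q b) = ?n b + of_bool (step a b \<and> \<not> N a b)"
      using a b by (simp add: step_def es)
    finally show ?thesis by (simp add: algebra_simps)
  qed
  show ?thesis
    unfolding W det_mult[OF family_mat_carrier family_mat_carrier, symmetric] family_mat_mult[OF es(1)]
    by (rule arg_cong[where f = det], rule family_mat_cong) (rule entry)
qed

section \<open>Ideals generated by paths of length two\<close>

lemma path_algebra_mult_apply: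
  "(f \<otimes>\<^bsub>path_algebra Q\<^esub> g) (u, r) =
    (\<Sum>(p, q)\<in>lsplits r. f (u, p) * g (pre_digraph.awlast Q u p, q))"
  by (simp add: path_algebra_def)

lemma path_algebra_mult_nonzeroE:
  assumes "(f \<otimes>\<^bsub>path_algebra Q\<^esub> g) (u, r) \<noteq> 0"
  obtains p q where "r = p @ q" "f (u, p) \<noteq> 0" "g (pre_digraph.awlast Q u p, q) \<noteq> 0"
proof -
  from assms obtain x where "x \<in> lsplits r"
    "(case x of (p, q) \<Rightarrow> f (u, p) * g (pre_digraph.awlast Q u p, q)) \<noteq> 0"
    unfolding path_algebra_mult_apply by (rule sum.not_neutral_contains_not_neutral)
  then show ?thesis using that by (cases x) auto
qed

lemma path_elt_carrier:
  assumes "pre_digraph.awalk Q u p v"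
  shows "path_elt (u, p) \<in> carrier (path_algebra Q)"
  using assms by (auto simp: path_algebra_def path_elt_def quiver_paths_def)

lemma path_elt_mult:
  fixes Q :: "('a, 'b) pre_digraph"
  assumes "pre_digraph.awlast Q u p = v"
  shows "path_elt (u, p) \<otimes>\<^bsub>path_algebra Q\<^esub> path_elt (v, q) = path_elt (u, p @ q)"
proof
  fix x :: "'a \<times> 'b list"
  obtain u' r where x: "x = (u', r)" by (cases x)
  have "(path_elt (u, p) \<otimes>\<^bsub>path_algebra Q\<^esub> path_elt (v, q)) x =
      (\<Sum>y\<in>lsplits r. if u' = u \<and> y = (p, q) then 1 else 0)"
    unfolding x path_algebra_mult_apply
    by (rule sum.cong) (use assms in \<open>auto simp: path_elt_def split: if_splits\<close>)
  also have "\<dots> = path_elt (u, p @ q) x"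
    by (cases "u' = u") (auto simp: path_elt_def x)
  finally show "(path_elt (u, p) \<otimes>\<^bsub>path_algebra Q\<^esub> path_elt (v, q)) x = path_elt (u, p @ q) x" .
qed

text \<open>
  For the property of containing a generating path, this is the monomial ideal spanned by the paths with
  that property.
\<close>

lemma support_ideal:
  assumes "fin_digraph Q" and P: "\<And>p q r. P q \<Longrightarrow> P (p @ q @ r)"
  shows "ideal {f \<in> carrier (path_algebra Q :: ('v \<times> 'e list \<Rightarrow> 'k::field) ring).
      \<forall>u p. f (u, p) \<noteq> 0 \<longrightarrow> P p} (path_algebra Q)"
    (is "ideal ?J ?R")
proof -
  interpret R: ring ?R by (rule ring_path_algebra) fact
  have l: "g \<otimes>\<^bsub>?R\<^esub> f \<in> ?J" if "f \<in> ?J" "g \<in> carrier ?R" for f g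
    using that P[of _ _ "[]"] by (auto elim!: path_algebra_mult_nonzeroE)
  have r: "f \<otimes>\<^bsub>?R\<^esub> g \<in> ?J" if "f \<in> ?J" "g \<in> carrier ?R" for f g
    using that P[of _ "[]"] by (auto elim!: path_algebra_mult_nonzeroE)
  have add: "f \<oplus>\<^bsub>?R\<^esub> g \<in> ?J" if f: "f \<in> ?J" and g: "g \<in> ?J" for f g
  proof -
    have eq: "(f \<oplus>\<^bsub>?R\<^esub> g) x = f x + g x" for x by (simp add: path_algebra_def)
    have "P p" if "(f \<oplus>\<^bsub>?R\<^esub> g) (u, p) \<noteq> 0" for u p
      using that f g by (cases "f (u, p) = 0") (auto simp: eq)
    then show ?thesis using f g by simp
  qed
  have neg: "\<ominus>\<^bsub>?R\<^esub> f \<in> ?J" if f: "f \<in> ?J" for f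
  proof -
    have "\<ominus>\<^bsub>?R\<^esub> f = \<ominus>\<^bsub>?R\<^esub> \<one>\<^bsub>?R\<^esub> \<otimes>\<^bsub>?R\<^esub> f" using f by (simp add: R.l_minus)
    then show ?thesis using l[OF f, of "\<ominus>\<^bsub>?R\<^esub> \<one>\<^bsub>?R\<^esub>"] by simp
  qed
  have zero: "\<zero>\<^bsub>?R\<^esub> \<in> ?J"
    using R.zero_closed by (simp add: path_algebra_def)
  show ?thesis
  proof (rule idealI)
    show "subgroup ?J (add_monoid ?R)"
    proof (rule group.subgroupI[OF R.a_group])
      show "?J \<subseteq> carrier (add_monoid ?R)" by auto
      show "?J \<noteq> {}" using zero by blast
      show "inv\<^bsub>add_monoid ?R\<^esub> f \<in> ?J" if "f \<in> ?J" for f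
        using neg[OF that] unfolding a_inv_def .
      show "f \<otimes>\<^bsub>add_monoid ?R\<^esub> g \<in> ?J" if "f \<in> ?J" "g \<in> ?J" for f g
        using add[OF that] by (simp only: monoid.select_convs)
    qed
  qed (fact R.ring_axioms l r)+
qed

lemma arrow_prod_in_iff:
  fixes I :: "('v \<times> 'e list \<Rightarrow> 'k::field) set"
  assumes "head Q a = tail Q b"
  shows "arrow_prod_in Q I a b \<longleftrightarrow> path_elt (tail Q a, [a, b]) \<in> I"
proof -
  have "path_elt (tail Q a, [a]) \<otimes>\<^bsub>path_algebra Q\<^esub> path_elt (tail Q b, [b]) =
      (path_elt (tail Q a, [a] @ [b]) :: _ \<Rightarrow> 'k)"
    by (rule path_elt_mult) (use assms in \<open>simp add: pre_digraph.awalk_verts.simps\<close>)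
  then show ?thesis by (simp add: arrow_prod_in_def arrow_elt_def)
qed

text \<open>
  An ideal generated by paths of length two is monomial: a path lies in it exactly if two of its consecutive
  arrows do. If a path contains a pair in \<open>I\<close>, it is a multiple of that pair. Conversely the elements
  supported on paths that contain a generator form an ideal, so every path in \<open>I\<close> contains a generator.
\<close>

theorem path_notin_ideal_iff:
  assumes Q: "fin_digraph Q" and S: "S \<subseteq> {p \<in> quiver_paths Q. length (snd p) = 2}"
    and I: "I = genideal (path_algebra Q :: ('v \<times> 'e list \<Rightarrow> 'k::field) ring) (path_elt ` S)"
    and p: "pre_digraph.awalk Q u p v"
  shows "path_elt (u, p) \<notin> I \<longleftrightarrow> successively (\<lambda>a b. \<not> arrow_prod_in Q I a b) p"
proof -
  interpret fin_digraph Q by fact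
  let ?R = "path_algebra Q :: ('v \<times> 'e list \<Rightarrow> 'k) ring"
  interpret R: ring ?R by (rule ring_path_algebra) fact
  have S_carrier: "path_elt ` S \<subseteq> carrier ?R"
    using S by (force simp: quiver_paths_def intro: path_elt_carrier)
  interpret I: ideal I ?R
    unfolding I by (rule R.genideal_ideal[OF S_carrier])
  have not_succ: "\<not> successively (\<lambda>a b. \<not> arrow_prod_in Q I a b) p \<longleftrightarrow>
      (\<exists>q a b r. p = q @ [a, b] @ r \<and> arrow_prod_in Q I a b)"
  proof -
    have "\<not> successively (\<lambda>a b. \<not> P a b) p \<longleftrightarrow> (\<exists>q a b r. p = q @ [a, b] @ r \<and> P a b)"
      for P :: "'e \<Rightarrow> 'e \<Rightarrow> bool" and p
    proof (induction p)
      case (Cons x p)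
      have "(\<exists>b r. p = b # r \<and> P x b) \<or> (\<exists>q a b r. p = q @ [a, b] @ r \<and> P a b)"
        if xp: "x # p = q @ [a, b] @ r" "P a b" for q a b r
      proof (cases q)
        case (Cons y q')
        then have "p = q' @ [a, b] @ r" using xp by simp
        then show ?thesis using xp(2) by blast
      qed (use xp in auto)
      moreover have "\<exists>q a b r. x # p = q @ [a, b] @ r \<and> P a b" if "p = b # r" "P x b" for b r
        using that by (intro exI[of _ "[]"]) auto
      moreover have "\<exists>q a b r. x # p = q @ [a, b] @ r \<and> P a b"
        if "p = q @ [a, b] @ r" "P a b" for q a b r
        using that by (intro exI[of _ "x # q"]) auto
      ultimately have "(\<exists>q a b r. x # p = q @ [a, b] @ r \<and> P a b) \<longleftrightarrow>
          (\<exists>b r. p = b # r \<and> P x b) \<or> (\<exists>q a b r. p = q @ [a, b] @ r \<and> P a b)"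
        by blast
      then show ?case using Cons by (cases p) (auto simp: successively_Cons)
    qed simp
    then show ?thesis .
  qed
  have "path_elt (u, p) \<in> I" if "p = q @ [a, b] @ r" "arrow_prod_in Q I a b" for q a b r
  proof -
    have walks: "awalk u q (tail Q a)" "awalk (tail Q a) [a, b] (head Q b)" "awalk (head Q b) r v"
      "head Q a = tail Q b"
      using p that(1) by (auto simp: awalk_append_iff awalk_Cons_iff awalk_Nil_iff dest: awlast_if_cas)
    have "path_elt (tail Q a, [a, b]) \<in> I" using that(2) walks(4) by (simp add: arrow_prod_in_iff)
    then have "path_elt (u, q) \<otimes>\<^bsub>?R\<^esub> (path_elt (tail Q a, [a, b]) \<otimes>\<^bsub>?R\<^esub> path_elt (head Q b, r)) \<in> I"
      using path_elt_carrier[OF walks(1)] path_elt_carrier[OF walks(3)]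
      by (intro I.I_l_closed I.I_r_closed)
    moreover have "path_elt (tail Q a, [a, b]) \<otimes>\<^bsub>?R\<^esub> path_elt (head Q b, r) =
        path_elt (tail Q a, [a, b] @ r)"
      by (rule path_elt_mult) simp
    moreover have "path_elt (u, q) \<otimes>\<^bsub>?R\<^esub> path_elt (tail Q a, [a, b] @ r) = path_elt (u, p)"
      unfolding that(1) using walks(1) by (intro path_elt_mult) (auto simp: awalk_def cas_awlast)
    ultimately show ?thesis by simp
  qed
  moreover have "\<exists>q a b r. p = q @ [a, b] @ r \<and> arrow_prod_in Q I a b" if pI: "path_elt (u, p) \<in> I"
  proof -
    \<comment> \<open>The path contains a generating path as a factor.\<close>
    let ?P = "\<lambda>p. \<exists>q a b r. p = q @ [a, b] @ r \<and> (tail Q a, [a, b]) \<in> S"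
    let ?J = "{f \<in> carrier ?R. \<forall>u p. f (u, p) \<noteq> 0 \<longrightarrow> ?P p}"
    \<comment> \<open>Closure under multiplication holds because a factor of a factor is a factor.\<close>
    have "ideal ?J ?R"
      by (rule support_ideal[OF Q, of ?P]) (metis append.assoc)
    moreover have "path_elt ` S \<subseteq> ?J"
    proof safe
      fix u' s assume s: "(u', s) \<in> S"
      then have len: "length s = 2" and "(u', s) \<in> quiver_paths Q" using S by auto
      then obtain v' where "awalk u' s v'" by (auto simp: quiver_paths_def)
      moreover obtain a b where ab: "s = [a, b]"
        using len by (auto simp: numeral_2_eq_2 length_Suc_conv)
      ultimately have "u' = tail Q a" by (simp add: awalk_Cons_iff)
      fix u p assume "path_elt (u', s) (u, p) \<noteq> (0 :: 'k)"
      then have "p = [a, b]" by (auto simp: path_elt_def ab split: if_splits)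
      then show "?P p" using s ab \<open>u' = tail Q a\<close> by (intro exI[of _ "[]"]) auto
    qed (use S_carrier in auto)
    ultimately have "I \<subseteq> ?J" unfolding I by (rule R.genideal_minimal)
    then have "?P p" using pI by (auto simp: path_elt_def)
    then obtain q a b r where ab: "p = q @ [a, b] @ r" "(tail Q a, [a, b]) \<in> S" by blast
    then have "head Q a = tail Q b"
      using p by (auto simp: awalk_append_iff awalk_Cons_iff)
    moreover have "path_elt (tail Q a, [a, b]) \<in> I"
      unfolding I using R.genideal_self[OF S_carrier] ab(2) by blast
    ultimately have "arrow_prod_in Q I a b" by (simp add: arrow_prod_in_iff)
    then show ?thesis using ab(1) by blast
  qed
  ultimately show ?thesis using not_succ by blast
qed

section \<open>Units and polynomials among power series\<close>

text \<open>
  The inverse is the geometric series of the monomial; its coefficients are \<open>1\<close> at the multiples of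
  \<open>mset p\<close> and \<open>0\<close> elsewhere.
\<close>

lemma monom_geometric_unit:
  assumes "p \<noteq> []"
  shows "(1 - path_weight mfps_X p :: ('e, 'a::comm_ring_1) mfps) dvd 1"
proof -
  let ?w = "path_weight mfps_X p :: ('e, 'a) mfps"
  define P where "P = (\<lambda>m. \<exists>k. m = repeat_mset k (mset p))"
  define g :: "('e, 'a) mfps" where "g = Abs_mfps (\<lambda>m. of_bool (P m))"
  have P_rec: "P m \<longleftrightarrow> m = {#} \<or> mset p \<subseteq># m \<and> P (m - mset p)" for m
  proof
    assume "P m"
    then obtain k where k: "m = repeat_mset k (mset p)" by (auto simp: P_def)
    show "m = {#} \<or> mset p \<subseteq># m \<and> P (m - mset p)"
      using k by (cases k) (auto simp: P_def)
  next
    assume "m = {#} \<or> mset p \<subseteq># m \<and> P (m - mset p)"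
    then show "P m"
    proof
      assume "m = {#}"
      then show ?thesis unfolding P_def by (intro exI[of _ 0]) simp
    next
      assume "mset p \<subseteq># m \<and> P (m - mset p)"
      then obtain k where "m - mset p = repeat_mset k (mset p)" "mset p \<subseteq># m" by (auto simp: P_def)
      then have "m = repeat_mset (Suc k) (mset p)"
        by (metis repeat_mset_Suc subset_mset.add_diff_inverse)
      then show ?thesis unfolding P_def by blast
    qed
  qed
  have "(1 - ?w) * g = g - ?w * g" by (simp add: algebra_simps)
  also have "\<dots> = 1"
  proof (rule mfps_eqI)
    fix m
    have "mfps_coeff (g - ?w * g) m =
        of_bool (P m) - of_bool (mset p \<subseteq># m \<and> P (m - mset p))"
      unfolding minus_mfps_def mfps_coeff_Abs mfps_coeff_monom_mult by (simp add: g_def)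
    also have "\<dots> = of_bool (m = {#})"
      using assms P_rec[of m] by auto
    finally show "mfps_coeff (g - ?w * g) m = mfps_coeff 1 m" by (simp add: one_mfps_def)
  qed
  finally show ?thesis by (metis dvdI)
qed

lemma prod_dvd_one:
  fixes f :: "'i \<Rightarrow> 'a::comm_ring_1"
  assumes "\<And>i. i \<in> A \<Longrightarrow> f i dvd 1"
  shows "prod f A dvd 1"
  using assms
proof (induction A rule: infinite_finite_induct)
  case (insert i A)
  then have "f i * prod f A dvd 1 * 1" by (intro mult_dvd_mono) auto
  then show ?case using insert.hyps by simp
qed auto

lemma mfps_polynomial_one: "mfps_polynomial E 1"
proof -
  have "{m. mfps_coeff (1 :: ('a, 'b) mfps) m \<noteq> 0} \<subseteq> {{#}}" by (auto simp: one_mfps_def)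
  then have "finite {m. mfps_coeff (1 :: ('a, 'b) mfps) m \<noteq> 0}" by (rule finite_subset) simp
  then show ?thesis by (auto simp: mfps_polynomial_def one_mfps_def)
qed

lemma mfps_polynomial_uminus: "mfps_polynomial E f \<Longrightarrow> mfps_polynomial E (- f)"
  by (simp add: mfps_polynomial_def uminus_mfps_def)

lemma mfps_polynomial_diff:
  assumes "mfps_polynomial E f" "mfps_polynomial E g"
  shows "mfps_polynomial E (f - g)"
proof -
  let ?S = "\<lambda>f. {m. mfps_coeff f m \<noteq> 0}"
  have sub: "?S (f - g) \<subseteq> ?S f \<union> ?S g" by (auto simp: minus_mfps_def)
  moreover have "finite (?S f \<union> ?S g)" using assms by (simp add: mfps_polynomial_def)
  ultimately have "finite (?S (f - g))" by (rule finite_subset)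
  then show ?thesis using sub assms unfolding mfps_polynomial_def by blast
qed

lemma mfps_polynomial_mult:
  assumes "mfps_polynomial E f" "mfps_polynomial E g"
  shows "mfps_polynomial E (f * g)"
proof -
  let ?S = "\<lambda>f. {m. mfps_coeff f m \<noteq> 0}"
  have sub: "?S (f * g) \<subseteq> (\<lambda>(a, b). a + b) ` (?S f \<times> ?S g)"
  proof
    fix m assume "m \<in> ?S (f * g)"
    then have "(\<Sum>(a, b)\<in>msplits m. mfps_coeff f a * mfps_coeff g b) \<noteq> 0"
      by (simp add: times_mfps_def)
    then obtain x where "x \<in> msplits m" "(case x of (a, b) \<Rightarrow> mfps_coeff f a * mfps_coeff g b) \<noteq> 0"
      by (rule sum.not_neutral_contains_not_neutral)
    then show "m \<in> (\<lambda>(a, b). a + b) ` (?S f \<times> ?S g)" by (intro image_eqI[of _ _ x]) auto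
  qed
  moreover have "finite ((\<lambda>(a, b). a + b) ` (?S f \<times> ?S g))"
    using assms by (simp add: mfps_polynomial_def)
  ultimately have "finite (?S (f * g))" by (rule finite_subset)
  moreover have "set_mset m \<subseteq> E" if "m \<in> ?S (f * g)" for m
    using subsetD[OF sub that] assms unfolding mfps_polynomial_def by fastforce
  ultimately show ?thesis unfolding mfps_polynomial_def by blast
qed

lemma mfps_polynomial_prod:
  assumes "\<And>i. i \<in> A \<Longrightarrow> mfps_polynomial E (f i)"
  shows "mfps_polynomial E (prod f A)"
  using assms
  by (induction A rule: infinite_finite_induct) (auto simp: mfps_polynomial_one mfps_polynomial_mult)

lemma mfps_polynomial_monom:
  assumes "set p \<subseteq> E"
  shows "mfps_polynomial E (path_weight mfps_X p :: ('e, 'a::comm_ring_1) mfps)"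
proof -
  have "{m. mfps_coeff (path_weight mfps_X p :: ('e, 'a) mfps) m \<noteq> 0} \<subseteq> {mset p}"
    by (auto simp: mfps_coeff_path_weight_X)
  then have "finite {m. mfps_coeff (path_weight mfps_X p :: ('e, 'a) mfps) m \<noteq> 0}"
    by (rule finite_subset) simp
  then show ?thesis using assms by (auto simp: mfps_polynomial_def mfps_coeff_path_weight_X)
qed

lemma mfps_polynomial_cycle_factor:
  assumes "set C \<subseteq> E"
  shows "mfps_polynomial E (1 - (-1) ^ n * path_weight mfps_X C :: ('e, 'a::comm_ring_1) mfps)"
proof -
  have "mfps_polynomial E ((-1) ^ n * path_weight mfps_X C :: ('e, 'a) mfps)"
    using mfps_polynomial_monom[OF assms] by (cases "even n") (auto intro: mfps_polynomial_uminus)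
  then show ?thesis by (intro mfps_polynomial_diff mfps_polynomial_one)
qed

section \<open>Cycles of arrows and the Cartan determinant\<close>

lemma (in wf_digraph) awalk_iff_successively:
  assumes "p \<noteq> []"
  shows "awalk u p v \<longleftrightarrow> set p \<subseteq> arcs G \<and> u = tail G (hd p) \<and> v = head G (last p) \<and>
    successively (\<lambda>a b. head G a = tail G b) p"
  using assms
proof (induction p arbitrary: u rule: list_nonempty_induct)
  case (single a)
  then show ?case by (auto simp: awalk_Cons_iff awalk_Nil_iff)
next
  case (cons a p)
  then show ?case by (auto simp: awalk_Cons_iff successively_Cons)
qed

text \<open>
  The cyclic composability of consecutive arrows, which \<open>trail\<close> expresses through a base point, becomes
  part of the relation, so that closed trails are the cycles of a relation on arrows.
\<close>

lemma (in wf_digraph) closed_trail_iff_cyclic_list: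
  "C \<noteq> [] \<and> (\<exists>u. trail u C u) \<and> (\<forall>i<length C. P (C ! i) (C ! (Suc i mod length C))) \<longleftrightarrow>
    cyclic_list (\<lambda>a b. (a \<in> arcs G \<and> b \<in> arcs G \<and> head G a = tail G b) \<and> P a b) C"
  (is "?L \<longleftrightarrow> cyclic_list ?r C")
proof
  assume L: ?L
  then obtain u where ne: "C \<noteq> []" and u: "awalk u C u" "distinct C"
    and P: "\<And>i. i < length C \<Longrightarrow> P (C ! i) (C ! (Suc i mod length C))"
    by (auto simp: trail_def)
  have walk: "set C \<subseteq> arcs G" "tail G (hd C) = head G (last C)"
    "successively (\<lambda>a b. head G a = tail G b) C"
    using u(1) unfolding awalk_iff_successively[OF ne] by auto
  have "?r (C ! i) (C ! (Suc i mod length C))" if i: "i < length C" for i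
  proof -
    have "Suc i mod length C < length C" using i by (intro mod_less_divisor) linarith
    then have "C ! i \<in> arcs G" "C ! (Suc i mod length C) \<in> arcs G" using i walk(1) by auto
    moreover have "head G (C ! i) = tail G (C ! (Suc i mod length C))"
    proof (cases "Suc i = length C")
      case True
      then have "i = length C - 1" by linarith
      then have "C ! i = last C" using ne by (simp add: last_conv_nth)
      then show ?thesis using True walk(2) ne by (simp add: hd_conv_nth)
    next
      case False
      then show ?thesis using i walk(3) by (simp add: successively_conv_nth)
    qed
    ultimately show ?thesis using P[OF i] by blast
  qed
  then show "cyclic_list ?r C" using ne u(2) by (simp add: cyclic_list_def)
next
  assume C: "cyclic_list ?r C"
  note r = cyclic_listD(3)[OF C]
  have ne: "C \<noteq> []" using cyclic_listD(1)[OF C] .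
  have "set C \<subseteq> arcs G" using r by (auto simp: in_set_conv_nth)
  moreover have "successively (\<lambda>a b. head G a = tail G b) C"
    unfolding successively_conv_nth
  proof (intro allI impI)
    fix i assume "Suc i < length C"
    then show "head G (C ! i) = tail G (C ! Suc i)" using r[of i] by simp
  qed
  moreover have "tail G (hd C) = head G (last C)"
    using r[of "length C - 1"] ne by (simp add: hd_conv_nth last_conv_nth)
  ultimately have "awalk (tail G (hd C)) C (tail G (hd C))"
    unfolding awalk_iff_successively[OF ne] by simp
  then have "trail (tail G (hd C)) C (tail G (hd C))"
    using cyclic_listD(2)[OF C] by (simp add: trail_def)
  then show ?L using ne r by blast
qed

lemma path_weight_uminus:
  fixes w :: "'e \<Rightarrow> 'a::comm_ring_1"
  shows "path_weight (\<lambda>a. - w a) p = (-1) ^ length p * path_weight w p"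
  by (induction p) (simp_all add: path_weight_def)

theorem mainTheorem1:
  fixes Q :: "('v, 'e) pre_digraph"
    and I :: "('v \<times> 'e list \<Rightarrow> 'k::field) set"
    and w :: "'e \<Rightarrow> ('e, int) mfps"
    and vs :: "'v list"
  assumes gentle: "locally_gentle Q I"
    and generic: "w = mfps_X"
    and vertices: "distinct vs" "set vs = verts Q"
  shows "mfps_rational (arcs Q) (det (cartan_matrix Q I w vs)) \<and>
    (\<Prod>C\<in>IC Q I. 1 - cycle_weight w C) dvd 1 \<and>
    det (cartan_matrix Q I w vs) =
      (\<Prod>C\<in>ZC Q I. 1 - (-1) ^ cycle_length C * cycle_weight w C) /
      (\<Prod>C\<in>IC Q I. 1 - cycle_weight w C)"
proof -
  have Q: "fin_digraph Q" using gentle by (simp add: locally_gentle_def)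
  interpret fin_digraph Q by (rule Q)
  obtain es where es: "distinct es" "set es = arcs Q"
    using finite_distinct_list[OF finite_arcs] by blast
  obtain S where S: "S \<subseteq> {p \<in> quiver_paths Q. length (snd p) = 2}"
    "I = genideal (path_algebra Q) (path_elt ` S)"
    using gentle by (auto simp: locally_gentle_def)
  let ?N = "\<lambda>a b. \<not> arrow_prod_in Q I a b"
  let ?step = "\<lambda>a b. a \<in> arcs Q \<and> b \<in> arcs Q \<and> head Q a = tail Q b"
  let ?num = "\<Prod>C\<in>ZC Q I. 1 - (-1) ^ cycle_length C * cycle_weight w C"
  let ?den = "\<Prod>C\<in>IC Q I. 1 - cycle_weight w C"
  let ?W = "\<lambda>i j. walk_series {p. awalk i p j \<and> successively ?N p} :: ('e, int) mfps"

  have cycles: "{C. no_relation_cycle Q I C} =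
      {C. cyclic_list (\<lambda>a b. ?step a b \<and> ?N a b) C \<and> set C \<subseteq> set es}"
    "{C. full_relation_cycle Q I C} =
      {C. cyclic_list (\<lambda>a b. ?step a b \<and> \<not> ?N a b) C \<and> set C \<subseteq> set es}"
  proof -
    have sub: "set C \<subseteq> set es" if "cyclic_list (\<lambda>a b. ?step a b \<and> P a b) C" for C P
      using cyclic_listD(3)[OF that] by (auto simp: in_set_conv_nth es)
    show "{C. no_relation_cycle Q I C} =
        {C. cyclic_list (\<lambda>a b. ?step a b \<and> ?N a b) C \<and> set C \<subseteq> set es}"
      unfolding no_relation_cycle_def closed_trail_iff_cyclic_list[where P = ?N]
      using sub[where P = ?N] by blast
    show "{C. full_relation_cycle Q I C} =
        {C. cyclic_list (\<lambda>a b. ?step a b \<and> \<not> ?N a b) C \<and> set C \<subseteq> set es}"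
      unfolding full_relation_cycle_def closed_trail_iff_cyclic_list[where P = "arrow_prod_in Q I"] not_not
      using sub[where P = "arrow_prod_in Q I"] by blast
  qed

  have matrix: "cartan_matrix Q I w vs = family_mat vs ?W"
  proof -
    have "cartan_entry Q I w = ?W"
    proof (intro ext)
      fix i j
      have "{p. awalk i p j \<and> path_elt (i, p) \<notin> I} = {p. awalk i p j \<and> successively ?N p}"
        using path_notin_ideal_iff[OF Q S] by blast
      then show "cartan_entry Q I w i j = ?W i j"
        by (simp add: cartan_entry_def walk_series_def generic)
    qed
    then show ?thesis by (simp add: cartan_matrix_def family_mat_def)
  qed

  have den: "det (family_mat es
      (\<lambda>a b. of_bool (a = b) + of_bool (?step a b \<and> ?N a b) * - mfps_X a)) = ?den"
  proof -
    have G3: "\<And>a. a \<in> arcs Q \<Longrightarrow> \<exists>\<^sub>\<le>\<^sub>1 b. b \<in> arcs Q \<and> ?N a b"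
      "\<And>a. a \<in> arcs Q \<Longrightarrow> \<exists>\<^sub>\<le>\<^sub>1 c. c \<in> arcs Q \<and> ?N c a"
      using gentle by (simp_all add: locally_gentle_def)
    \<comment> \<open>The weights \<open>- mfps_X a\<close> give each cycle a second factor \<open>(-1) ^ l\<close>, which cancels the first.\<close>
    have "det (family_mat es
        (\<lambda>a b. of_bool (a = b) + of_bool (?step a b \<and> ?N a b) * - mfps_X a)) =
      (\<Prod>C\<in>IC Q I. 1 - (-1) ^ cycle_length C * cycle_weight (\<lambda>a. - mfps_X a) C)"
      unfolding IC_def cycles(1)
      by (rule det_partial_bijection[OF _ _ es(1)]) (use G3 in \<open>auto dest!: Uniq_D\<close>)
    also have "\<dots> = ?den"
    proof (rule prod.cong[OF refl])
      fix K assume "K \<in> IC Q I"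
      then obtain C where "K = rotation `` {C}" unfolding IC_def by (rule quotientE)
      then show "1 - (-1) ^ cycle_length K * cycle_weight (\<lambda>a. - mfps_X a) K = 1 - cycle_weight w K"
        by (simp add: cycle_length_class cycle_weight_class path_weight_uminus generic
            flip: mult.assoc power_mult_distrib)
    qed
    finally show ?thesis .
  qed

  have num: "det (family_mat es
      (\<lambda>a b. of_bool (a = b) + of_bool (?step a b \<and> \<not> ?N a b) * mfps_X a)) = ?num"
  proof -
    have G5: "\<And>a. a \<in> arcs Q \<Longrightarrow> \<exists>\<^sub>\<le>\<^sub>1 b. b \<in> arcs Q \<and> head Q a = tail Q b \<and> \<not> ?N a b"
      "\<And>a. a \<in> arcs Q \<Longrightarrow> \<exists>\<^sub>\<le>\<^sub>1 c. c \<in> arcs Q \<and> head Q c = tail Q a \<and> \<not> ?N c a"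
      using gentle by (simp_all add: locally_gentle_def)
    show ?thesis
      unfolding ZC_def cycles(2) generic
    proof (rule det_partial_bijection[OF _ _ es(1)])
      fix a b c
      show "b = c" if "?step a b \<and> \<not> ?N a b" "?step a c \<and> \<not> ?N a c"
        using that Uniq_D[OF G5(1), of a b c] by auto
      show "a = b" if "?step a c \<and> \<not> ?N a c" "?step b c \<and> \<not> ?N b c"
        using that Uniq_D[OF G5(2), of c a b] by auto
    qed
  qed

  have "det (family_mat es
        (\<lambda>a b. of_bool (a = b) + of_bool (?step a b \<and> ?N a b) * - mfps_X a)) *
      det (family_mat vs ?W) =
    det (family_mat es (\<lambda>a b. of_bool (a = b) + of_bool (?step a b \<and> \<not> ?N a b) * mfps_X a))"
    by (rule det_walk_matrix[OF Q vertices es])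
  then have eq: "?den * det (cartan_matrix Q I w vs) = ?num"
    unfolding matrix den num .

  have unit: "?den dvd 1"
  proof (rule prod_dvd_one)
    fix K assume "K \<in> IC Q I"
    then obtain C where "K = rotation `` {C}" "no_relation_cycle Q I C"
      unfolding IC_def by (auto elim: quotientE)
    then show "1 - cycle_weight w K dvd 1"
      by (simp add: cycle_weight_class generic monom_geometric_unit no_relation_cycle_def)
  qed
  have "?den * inverse ?den = 1" by (rule mfps_mult_inverse[OF unit])

  have "mfps_polynomial (arcs Q) ?num"
  proof (rule mfps_polynomial_prod)
    fix K assume "K \<in> ZC Q I"
    then obtain C where "K = rotation `` {C}" "set C \<subseteq> arcs Q"
      unfolding ZC_def cycles(2) es(2) by (auto elim: quotientE)
    then show "mfps_polynomial (arcs Q) (1 - (-1) ^ cycle_length K * cycle_weight w K)"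
      by (simp add: cycle_length_class cycle_weight_class generic mfps_polynomial_cycle_factor)
  qed
  moreover have "mfps_polynomial (arcs Q) ?den"
  proof (rule mfps_polynomial_prod)
    fix K assume "K \<in> IC Q I"
    then obtain C where "K = rotation `` {C}" "set C \<subseteq> arcs Q"
      unfolding IC_def cycles(1) es(2) by (auto elim: quotientE)
    then show "mfps_polynomial (arcs Q) (1 - cycle_weight w K)"
      using mfps_polynomial_cycle_factor[of C "arcs Q" 0]
      by (simp add: cycle_weight_class generic)
  qed
  moreover have "?den \<noteq> 0"
    using \<open>?den * inverse ?den = 1\<close> by (metis mult_zero_left zero_neq_one)
  ultimately have "mfps_rational (arcs Q) (det (cartan_matrix Q I w vs))"
    unfolding mfps_rational_def using eq by blast
  moreover have "det (cartan_matrix Q I w vs) = ?num / ?den"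
  proof -
    have "?num / ?den = ?den * det (cartan_matrix Q I w vs) * inverse ?den"
      unfolding divide_mfps_def eq ..
    also have "\<dots> = (?den * inverse ?den) * det (cartan_matrix Q I w vs)"
      by (simp only: mult_ac)
    finally show ?thesis unfolding \<open>?den * inverse ?den = 1\<close> by simp
  qed
  ultimately show ?thesis using unit by blast
qed

end
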